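(* As formal power series in $x$, $$1+\sum_{n=1}^{\infty}X_n(a,1,b,1,p,q,y,t)\,x^{n}=\cfrac{1}{1-\beta_0x-\cfrac{\lambda_1x^2}{1-\beta_1x-\cfrac{\lambda_2x^2}{1-\beta_2x-\cdots}}}$$ where for all $n\ge1$ $$\beta_{n-1}=(1+ty)\,[a,n]_{p,q}\,[b,n]_{q,p},\qquad \lambda_n=t\,[a,n]_{p,q}\,[a,n+1]_{p,q}\,[b,n]_{q,p}\,[b,n+1]_{q,p}.$$ Moreover, for all $n\ge 1$, the following $\gamma$-formula holds: $$X_n(a,1,b,1,p,q,y,t)=\sum_{k=0}^{\lfloor n/2\rfloor}\gamma_{n,k}(a,b,p,q)\,t^k(1+yt)^{n-2k},$$ with coefficients $$\gamma_{n,k}(a,b,p,q)=\sum_{\sigma\in\overline{\mathcal X}_{2n,k}}a^{\mathrm{lema}\,\sigma}b^{\mathrm{romi}\,\sigma}p^{(2\text{-}31)\sigma}q^{(31\text{-}2)\sigma}.$$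
   Context: Permutations $\sigma\in\mathfrak S_m$ of $[m]=\{1,\dots,m\}$ are written as words $\sigma_1\cdots\sigma_m$. A descent of $\sigma$ is a pair $(\sigma_i,\sigma_{i+1})$ with $\sigma_i>\sigma_{i+1}$; $\sigma_i$ is the descent top and $\sigma_{i+1}$ the descent bottom; $\mathrm{des}\,\sigma$ is the number of descents. A descent is even-odd if its top is even and its bottom is odd. $\mathcal X_{2n}$ is the set of $\sigma\in\mathfrak S_{2n}$ all of whose descents are even-odd. $\mathrm{dom}(\sigma)$ is the number of $j\in[n]$ such that $2j$ is a descent top and $2j-1$ is a descent bottom of $\sigma\in\mathcal X_{2n}$ (not necessarily of the same descent). $\overline{\mathcal X}_{2n}$ (the set of $\mathcal E$-permutations) is the set of $\sigma\in\mathcal X_{2n}$ such that for no $j\in[n]$ are $2j-1$ and $2j$ simultaneously a descent bottom and a descent top of $\sigma$; $\overline{\mathcal X}_{2n,k}=\{\sigma\in\overline{\mathcal X}_{2n}:\mathrm{des}\,\sigma=k\}$. The value $\sigma_i$ is a left-to-right maximum if $\sigma_j<\sigma_i$ for all $j<i$, and a right-to-left minimum if $\sigma_i<\sigma_j$ for all $j>i$. $\mathrm{lema}\,\sigma$ and $\mathrm{loma}\,\sigma$ are the numbers of even and odd left-to-right maxima; $\mathrm{remi}\,\sigma$ and $\mathrm{romi}\,\sigma$ the numbers of even and odd right-to-left minima. For $\sigma\in\mathfrak S_m$, $(31\text{-}2)\sigma$ is the number of pairs $(i,j)$ with $2\le i<j\le m$ and $\sigma_{i-1}>\sigma_j>\sigma_i$;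 $(2\text{-}31)\sigma$ is the number of pairs $(i,j)$ with $1\le i<j\le m-1$ and $\sigma_j>\sigma_i>\sigma_{j+1}$. $$X_n(a,\bar a,b,\bar b,p,q,y,t)=\sum_{\sigma\in\mathcal X_{2n}}a^{\mathrm{lema}\,\sigma}\bar a^{\mathrm{loma}\,\sigma}b^{\mathrm{romi}\,\sigma}\bar b^{\mathrm{remi}\,\sigma}p^{(2\text{-}31)\sigma}q^{(31\text{-}2)\sigma}y^{\mathrm{dom}\,\sigma}t^{\mathrm{des}\,\sigma}.$$ For $n\ge1$, $[x,n]_{p,q}=xp^{n-1}+\sum_{i=1}^{n-1}p^{n-1-i}q^i$ (so $[x,1]_{p,q}=x$), and $[x,n]_{q,p}$ is obtained by exchanging $p$ and $q$. *)

theory Defs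
  imports
    "HOL-Combinatorics.Permutations"
    "HOL-Computational_Algebra.Formal_Power_Series"
begin

text \<open>A permutation of $\{1,\dots,m\}$ is a function \<open>\<sigma> permutes {1..m}\<close>; its word is
  \<open>\<sigma> 1, \<dots>, \<sigma> m\<close>. Outside of \<open>{1..m}\<close> such a function is the identity, so all statistics
  take the length \<open>m\<close> as an argument and only look at positions in \<open>{1..m}\<close>.\<close>

definition descents :: "nat \<Rightarrow> (nat \<Rightarrow> nat) \<Rightarrow> (nat \<times> nat) set" where
  "descents m \<sigma> = {(\<sigma> i, \<sigma> (i + 1)) | i. 1 \<le> i \<and> i < m \<and> \<sigma> i > \<sigma> (i + 1)}"

definition des :: "nat \<Rightarrow> (nat \<Rightarrow> nat) \<Rightarrow> nat" where
  "des m \<sigma> = card (descents m \<sigma>)"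

definition descent_tops :: "nat \<Rightarrow> (nat \<Rightarrow> nat) \<Rightarrow> nat set" where
  "descent_tops m \<sigma> = fst ` descents m \<sigma>"

definition descent_bottoms :: "nat \<Rightarrow> (nat \<Rightarrow> nat) \<Rightarrow> nat set" where
  "descent_bottoms m \<sigma> = snd ` descents m \<sigma>"

definition lr_maxima :: "nat \<Rightarrow> (nat \<Rightarrow> nat) \<Rightarrow> nat set" where
  "lr_maxima m \<sigma> = {\<sigma> i | i. i \<in> {1..m} \<and> (\<forall>j\<in>{1..m}. j < i \<longrightarrow> \<sigma> j < \<sigma> i)}"

definition rl_minima :: "nat \<Rightarrow> (nat \<Rightarrow> nat) \<Rightarrow> nat set" where
  "rl_minima m \<sigma> = {\<sigma> i | i. i \<in> {1..m} \<and> (\<forall>j\<in>{1..m}. j > i \<longrightarrow> \<sigma> i < \<sigma> j)}"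

definition lema :: "nat \<Rightarrow> (nat \<Rightarrow> nat) \<Rightarrow> nat" where
  "lema m \<sigma> = card {v \<in> lr_maxima m \<sigma>. even v}"

definition loma :: "nat \<Rightarrow> (nat \<Rightarrow> nat) \<Rightarrow> nat" where
  "loma m \<sigma> = card {v \<in> lr_maxima m \<sigma>. odd v}"

definition remi :: "nat \<Rightarrow> (nat \<Rightarrow> nat) \<Rightarrow> nat" where
  "remi m \<sigma> = card {v \<in> rl_minima m \<sigma>. even v}"

definition romi :: "nat \<Rightarrow> (nat \<Rightarrow> nat) \<Rightarrow> nat" where
  "romi m \<sigma> = card {v \<in> rl_minima m \<sigma>. odd v}"

definition pat31_2 :: "nat \<Rightarrow> (nat \<Rightarrow> nat) \<Rightarrow> nat" where
  "pat31_2 m \<sigma> = card {(i, j). 2 \<le> i \<and> i < j \<and> j \<le> m \<and> \<sigma> (i - 1) > \<sigma> j \<and> \<sigma> j > \<sigma> i}"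

definition pat2_31 :: "nat \<Rightarrow> (nat \<Rightarrow> nat) \<Rightarrow> nat" where
  "pat2_31 m \<sigma> = card {(i, j). 1 \<le> i \<and> i < j \<and> j \<le> m - 1 \<and> \<sigma> j > \<sigma> i \<and> \<sigma> i > \<sigma> (j + 1)}"

text \<open>The index \<open>n\<close> below refers to permutations of \<open>{1..2 * n}\<close>.\<close>

definition X_perms :: "nat \<Rightarrow> (nat \<Rightarrow> nat) set" where
  "X_perms n = {\<sigma>. \<sigma> permutes {1..2 * n} \<and> (\<forall>(u, v)\<in>descents (2 * n) \<sigma>. even u \<and> odd v)}"

definition dom_stat :: "nat \<Rightarrow> (nat \<Rightarrow> nat) \<Rightarrow> nat" where
  "dom_stat n \<sigma> = card {j \<in> {1..n}.
     2 * j \<in> descent_tops (2 * n) \<sigma> \<and> 2 * j - 1 \<in> descent_bottoms (2 * n) \<sigma>}"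

definition E_perms :: "nat \<Rightarrow> (nat \<Rightarrow> nat) set" where
  "E_perms n = {\<sigma> \<in> X_perms n. \<not> (\<exists>j\<in>{1..n}.
     2 * j - 1 \<in> descent_bottoms (2 * n) \<sigma> \<and> 2 * j \<in> descent_tops (2 * n) \<sigma>)}"

definition E_perms_des :: "nat \<Rightarrow> nat \<Rightarrow> (nat \<Rightarrow> nat) set" where
  "E_perms_des n k = {\<sigma> \<in> E_perms n. des (2 * n) \<sigma> = k}"

definition X_poly ::
  "nat \<Rightarrow> 'a \<Rightarrow> 'a \<Rightarrow> 'a \<Rightarrow> 'a \<Rightarrow> 'a \<Rightarrow> 'a \<Rightarrow> 'a \<Rightarrow> 'a \<Rightarrow> 'a::comm_ring_1" where
  "X_poly n a a' b b' p q y t = (\<Sum>\<sigma>\<in>X_perms n.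
     a ^ lema (2 * n) \<sigma> * a' ^ loma (2 * n) \<sigma> * b ^ romi (2 * n) \<sigma> * b' ^ remi (2 * n) \<sigma> *
     p ^ pat2_31 (2 * n) \<sigma> * q ^ pat31_2 (2 * n) \<sigma> * y ^ dom_stat n \<sigma> * t ^ des (2 * n) \<sigma>)"

definition gamma_coeff :: "nat \<Rightarrow> nat \<Rightarrow> 'a \<Rightarrow> 'a \<Rightarrow> 'a \<Rightarrow> 'a \<Rightarrow> 'a::comm_ring_1" where
  "gamma_coeff n k a b p q = (\<Sum>\<sigma>\<in>E_perms_des n k.
     a ^ lema (2 * n) \<sigma> * b ^ romi (2 * n) \<sigma> * p ^ pat2_31 (2 * n) \<sigma> * q ^ pat31_2 (2 * n) \<sigma>)"

text \<open>\<open>pq_bracket x n p q\<close> is $[x,n]_{p,q}$; it is only meaningful for \<open>n \<ge> 1\<close>.\<close>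

definition pq_bracket :: "'a \<Rightarrow> nat \<Rightarrow> 'a \<Rightarrow> 'a \<Rightarrow> 'a::comm_ring_1" where
  "pq_bracket x n p q = x * p ^ (n - 1) + (\<Sum>i=1..n - 1. p ^ (n - 1 - i) * q ^ i)"

text \<open>\<open>J_convergent \<beta> lam N k\<close> is the finite continued fraction
  $$\cfrac{1}{1-\beta_k x-\cfrac{\lambda_{k+1}x^2}{1-\beta_{k+1}x-\cdots
    -\cfrac{\lambda_{k+N}x^2}{1-\beta_{k+N}x}}}$$
  where \<open>lam i\<close> is written $\lambda_i$. The infinite J-fraction starting at \<open>\<beta> 0\<close> is the
  limit of \<open>J_convergent \<beta> lam N 0\<close> as \<open>N\<close> tends to infinity. The value \<open>lam 0\<close> is never used.\<close>

primrec J_convergent :: "(nat \<Rightarrow> 'a) \<Rightarrow> (nat \<Rightarrow> 'a) \<Rightarrow> nat \<Rightarrow> nat \<Rightarrow> 'a::field fps" where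
  "J_convergent \<beta> lam 0 k = 1 / (1 - fps_const (\<beta> k) * fps_X)"
| "J_convergent \<beta> lam (Suc N) k =
     1 / (1 - fps_const (\<beta> k) * fps_X
            - fps_const (lam (k + 1)) * fps_X ^ 2 * J_convergent \<beta> lam N (k + 1))"

text \<open>The limit is taken in the metric of \<^typ>\<open>'a fps\<close>, that is, in the $x$-adic topology.\<close>

definition has_J_fraction :: "'a::field fps \<Rightarrow> (nat \<Rightarrow> 'a) \<Rightarrow> (nat \<Rightarrow> 'a) \<Rightarrow> bool" where
  "has_J_fraction F \<beta> lam \<longleftrightarrow> (\<lambda>N. J_convergent \<beta> lam N 0) \<longlonglongrightarrow> F"

end

theory Submission
  imports Defs "HOL-Computational_Algebra.Polynomial"
begin

text \<open>
  Frame a permutation \<open>\<sigma>\<close> in $\mathcal X_{2n}$ by $0$ and $2n+1$ and build its word by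
  inserting the letters $1, 2, \dots, 2n$ in this order, each maximal block of letters still
  to come being represented by one gap. At the start the word consists of $0$ and a gap. A new
  letter goes into one of the $k$ gaps present. Because descents are even-odd, an odd letter
  either leaves a gap on its right or splits its gap into two, becoming a descent bottom, and
  an even letter either leaves a gap on its right or fills its gap (not the last one),
  becoming a descent top.

  The statistics are local in this process. Let a new letter have $i$ gaps on its left and $j$
  gaps on its right, not counting the gap that it enters. The descents of \<open>\<sigma>\<close> across it
  lead from a gap to the letter following that gap, and every gap but the final one is
  followed by a letter. So the new letter is the $2$ in $i$ patterns $31$-$2$, and in $j$
  patterns $2$-$31$ if it leaves a gap on its right or $j-1$ if it fills its gap. An even
  letter is a left-to-right maximum if and only if $i=0$, and an odd one is a right-to-left
  minimum if and only if it enters the last gap. Later insertions do not change this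
  (\<open>same_view_replace_larger\<close>, \<open>word_weight_insert\<close>). Hence, with $k$ gaps before the
  insertion, the sum of the weights over all choices of the gap is $[b,k]_{q,p}$ for an odd
  letter, in both cases, $[a,k]_{p,q}$ for an even letter that keeps its gap, and
  $[a,k-1]_{p,q}$ for one that fills it.

  Reading the letters in pairs $2j-1, 2j$ turns this into a Motzkin path of length $n$, whose
  height is the number of gaps minus one (\<open>level_weight_step\<close>). An up step means that $2j-1$
  is a descent bottom and $2j$ not a descent top, a down step the reverse; a level step means
  neither or both, and these two possibilities have weights in the ratio $1 : ty$. So the
  level step with $k$ gaps has weight $(1+ty)[a,k]_{p,q}[b,k]_{q,p}$, and the product of the
  up step from $k$ to $k+1$ gaps and of the down step back is $\lambda_k$.

  The J-fraction is Flajolet's theorem for these paths; it is proved here by eliminating the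
  linear system for the generating functions of paths ending at a given height
  (\<open>motzkin_J_fraction\<close>). For the $\gamma$-formula, sort the paths by the number $k$ of up
  steps: there are $n-2k$ level steps, each with a factor $1+ty$ (\<open>motzkin_expansion\<close>).
  Removing that factor amounts to setting $y=0$, which leaves the permutations with
  $\mathrm{dom}=0$, the $\mathcal E$-permutations, and for these $k$ is the number of descents
  (\<open>gamma_coeff_eq_motzkin_coeff\<close>).
\<close>

section \<open>What one letter sees of a word\<close>

text \<open>
  The value \<open>straddles x w\<close> counts the descents of \<open>w\<close> that jump over \<open>x\<close>. Applied to the part
  of the word after \<open>x\<close>, it counts the patterns $2$-$31$ in which \<open>x\<close> plays the role of $2$;
  applied to the part before \<open>x\<close>, the patterns $31$-$2$. Attributing each pattern to its
  letter $2$ is what makes the statistics additive over the insertion of letters in increasing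
  order.
\<close>

fun straddles :: "nat \<Rightarrow> nat list \<Rightarrow> nat" where
  "straddles x (u # v # w) = (if v < x \<and> x < u then 1 else 0) + straddles x (v # w)"
| "straddles x w = 0"

definition before :: "nat \<Rightarrow> nat list \<Rightarrow> nat list" where
  "before x w = takeWhile (\<lambda>z. z \<noteq> x) w"

definition after :: "nat \<Rightarrow> nat list \<Rightarrow> nat list" where
  "after x w = tl (dropWhile (\<lambda>z. z \<noteq> x) w)"

definition is_bottom :: "nat \<Rightarrow> nat list \<Rightarrow> bool" where
  "is_bottom x w \<longleftrightarrow> before x w \<noteq> [] \<and> x < last (before x w)"

definition is_top :: "nat \<Rightarrow> nat list \<Rightarrow> bool" where
  "is_top x w \<longleftrightarrow> after x w \<noteq> [] \<and> hd (after x w) < x"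

lemma before_split: "x \<notin> set u \<Longrightarrow> before x (u @ x # z) = u"
  by (induction u) (auto simp: before_def)

lemma after_split: "x \<notin> set u \<Longrightarrow> after x (u @ x # z) = z"
  by (induction u) (auto simp: after_def)

lemma straddles_append:
  "straddles x (u @ w) = straddles x u + straddles x w +
     (if u \<noteq> [] \<and> w \<noteq> [] \<and> hd w < x \<and> x < last u then 1 else 0)"
proof (induction x u rule: straddles.induct)
  case ("2_2" x v)
  then show ?case by (cases w) auto
qed auto

lemma straddles_all_greater: "\<forall>z\<in>set w. x < z \<Longrightarrow> straddles x w = 0"
  by (induction x w rule: straddles.induct) auto

text \<open>
  Two words have the same view from \<open>x\<close> if they cannot be told apart by the statistics that
  enter the weight of the letter \<open>x\<close>.
\<close>

definition same_view :: "nat \<Rightarrow> nat list \<Rightarrow> nat list \<Rightarrow> bool" where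
  "same_view x w w' \<longleftrightarrow>
     straddles x (before x w) = straddles x (before x w') \<and>
     straddles x (after x w) = straddles x (after x w') \<and>
     is_bottom x w = is_bottom x w' \<and> is_top x w = is_top x w' \<and>
     (\<forall>z\<in>set (before x w). z < x) = (\<forall>z\<in>set (before x w'). z < x) \<and>
     (\<forall>z\<in>set (after x w). x < z) = (\<forall>z\<in>set (after x w'). x < z)"

text \<open>
  A letter \<open>x\<close> only compares the other letters with itself, and a maximal block of larger
  letters acts on it like a single larger letter: inside the block there is no descent across
  \<open>x\<close>, and the two borders of the block behave in the same way whatever its length. Hence
  everything that will be inserted later into a gap is invisible to the letters already
  present.
\<close>

lemma same_view_replace_larger:
  assumes "c \<noteq> []" "d \<noteq> []" "\<forall>z\<in>set c. x < z" "\<forall>z\<in>set d. x < z"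
    and x: "x \<in> set u \<union> set w"
  shows "same_view x (u @ c @ w) (u @ d @ w)"
proof (cases "x \<in> set u")
  case True
  then obtain u1 u2 where u: "u = u1 @ x # u2" "x \<notin> set u1"
    by (metis split_list_first)
  have "hd c > x" "hd d > x"
    using assms by auto
  then have "\<not> hd c < x" "\<not> hd d < x"
    by simp_all
  then show ?thesis
    using assms(1-4) straddles_all_greater[of c x] straddles_all_greater[of d x]
    by (cases "u2 = []")
       (auto simp: same_view_def is_bottom_def is_top_def before_split[OF u(2)] after_split[OF u(2)]
          u(1) straddles_append hd_append)
next
  case False
  with x obtain w1 w2 where w: "w = w1 @ x # w2" "x \<notin> set w1"
    by (metis UnE split_list_first)
  have n: "x \<notin> set (u @ c @ w1)" "x \<notin> set (u @ d @ w1)"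
    using False w assms by auto
  have e: "u @ c @ w = (u @ c @ w1) @ x # w2" "u @ d @ w = (u @ d @ w1) @ x # w2"
    using w by auto
  have "hd c > x" "hd d > x"
    using assms by auto
  then have "\<not> hd c < x" "\<not> hd d < x" by linarith+
  moreover have "last c > x" "last d > x" using assms by auto
  ultimately have h: "\<not> hd c < x" "\<not> hd d < x" "last c > x" "last d > x" by blast+
  have b: "\<not> (\<forall>z\<in>set c. z < x)" "\<not> (\<forall>z\<in>set d. z < x)"
    using assms by (meson hd_in_set less_asym)+
  show ?thesis
    unfolding same_view_def is_bottom_def is_top_def e before_split[OF n(1)] after_split[OF n(1)]
      before_split[OF n(2)] after_split[OF n(2)]
    using assms(1-4) h b straddles_all_greater[of c x] straddles_all_greater[of d x]
    by (cases "w1 = []") (auto simp: straddles_append)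
qed

section \<open>Words with gaps\<close>

text \<open>
  A word of \<open>gap_words g v\<close> is what remains of a permutation in $\mathcal X_{2n}$, framed by
  $0$ and $2n+1$, when every maximal block of letters exceeding \<open>v\<close> is replaced by one gap.
  The gap is written as the letter \<open>g > v\<close>, so that comparisons with a gap come out as for the
  letters that it stands for. The relation \<open>allowed\<close> on neighbours says that descents are
  even-odd, a gap counting as a possible descent top; as it is irreflexive, two gaps are never
  adjacent.
\<close>

definition allowed :: "nat \<Rightarrow> nat \<Rightarrow> nat \<Rightarrow> bool" where
  "allowed g x y \<longleftrightarrow> x < y \<or> (y < x \<and> (even x \<or> x = g) \<and> odd y)"

definition gap_words :: "nat \<Rightarrow> nat \<Rightarrow> nat list set" where
  "gap_words g v = {w. w \<noteq> [] \<and> hd w = 0 \<and> last w = g \<and> set w = insert g {0..v} \<and>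
     distinct (filter (\<lambda>z. z \<noteq> g) w) \<and> successively (allowed g) w}"

text \<open>
  A word with one of its gaps marked, as the pair of the parts before and after that gap.
\<close>

definition pointed :: "nat \<Rightarrow> nat \<Rightarrow> (nat list \<times> nat list) set" where
  "pointed g v = {(u, w). u @ g # w \<in> gap_words g v}"

text \<open>
  A word breaks at a gap into independent parts: as a gap is neither preceded by a gap nor
  followed by a gap, the parts interact only in that they share no letter and the second one
  starts with an odd letter. With \<open>pointedI\<close> this is a characterisation, which reduces the
  insertions below to properties of the two parts.
\<close>

lemma pointedD:
  assumes "(u, w) \<in> pointed g v" "v < g"
  shows "u \<noteq> []" "hd u = 0" "last u < g" "last u \<le> v" "w \<noteq> [] \<Longrightarrow> last w = g"
    "w \<noteq> [] \<Longrightarrow> hd w < g" "w \<noteq> [] \<Longrightarrow> odd (hd w)" "w \<noteq> [] \<Longrightarrow> hd w \<le> v"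
    "set u \<union> set w \<subseteq> insert g {0..v}" "{0..v} \<subseteq> set u \<union> set w"
    "successively (allowed g) u" "successively (allowed g) w"
    "distinct (filter (\<lambda>z. z \<noteq> g) u)" "distinct (filter (\<lambda>z. z \<noteq> g) w)"
    "set u \<inter> set w \<subseteq> {g}"
proof -
  have a: "u @ g # w \<in> gap_words g v" using assms by (simp add: pointed_def)
  show 1: "u \<noteq> []" using a assms(2) by (cases u) (auto simp: gap_words_def)
  show "hd u = 0" using a 1 by (auto simp: gap_words_def)
  show lw: "w \<noteq> [] \<Longrightarrow> last w = g" using a by (auto simp: gap_words_def)
  show s: "set u \<union> set w \<subseteq> insert g {0..v}" using a by (auto simp: gap_words_def)
  have suc: "successively (allowed g) (u @ g # w)" using a by (auto simp: gap_words_def)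
  show "successively (allowed g) u" "successively (allowed g) w"
    using suc by (auto simp: successively_append_iff successively_Cons)
  have lu: "last u \<noteq> g" using suc 1 by (auto simp: successively_append_iff allowed_def)
  have "last u \<in> set u" using 1 by simp
  then show "last u \<le> v" using lu s by auto
  then show "last u < g" using assms(2) by simp
  { assume w: "w \<noteq> []"
    have "allowed g g (hd w)" using suc w by (auto simp: successively_append_iff successively_Cons)
    then have o: "hd w \<noteq> g" "hd w < g \<Longrightarrow> odd (hd w)" by (auto simp: allowed_def)
    have "hd w \<in> set w" using w by simp
    then have "hd w \<le> v" using s o by auto
    then have "hd w \<le> v \<and> hd w < g \<and> odd (hd w)" using assms o by auto }
  then show "w \<noteq> [] \<Longrightarrow> hd w < g" "w \<noteq> [] \<Longrightarrow> odd (hd w)" "w \<noteq> [] \<Longrightarrow> hd w \<le> v"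
    by auto
  show "{0..v} \<subseteq> set u \<union> set w" 
  proof
    fix x assume "x \<in> {0..v}"
    moreover from this have "x \<noteq> g" using assms(2) by auto
    ultimately show "x \<in> set u \<union> set w" using a by (auto simp: gap_words_def)
  qed
  show "distinct (filter (\<lambda>z. z \<noteq> g) u)" "distinct (filter (\<lambda>z. z \<noteq> g) w)"
    "set u \<inter> set w \<subseteq> {g}"
    using a by (auto simp: gap_words_def)
qed

lemma pointedI:
  assumes "u \<noteq> []" "hd u = 0" "last u < g" "w \<noteq> [] \<Longrightarrow> last w = g"
    "w \<noteq> [] \<Longrightarrow> hd w < g" "w \<noteq> [] \<Longrightarrow> odd (hd w)"
    "set u \<union> set w \<subseteq> insert g {0..v}" "{0..v} \<subseteq> set u \<union> set w"
    "successively (allowed g) u" "successively (allowed g) w"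
    "distinct (filter (\<lambda>z. z \<noteq> g) u)" "distinct (filter (\<lambda>z. z \<noteq> g) w)"
    "set u \<inter> set w \<subseteq> {g}"
  shows "(u, w) \<in> pointed g v"
  using assms unfolding pointed_def gap_words_def
  by (auto simp: successively_append_iff successively_Cons allowed_def)

section \<open>Inserting the next letter\<close>

text \<open>
  The letter \<open>v + 1\<close> enters a marked gap and either leaves a gap to its right, or leaves gaps
  on both sides (it is then a descent bottom), or fills the gap (it is then a descent top).
  Leaving a gap only to its left would make it both a top and a bottom, which the parities
  forbid.
\<close>

definition ascent_insert :: "nat \<Rightarrow> nat \<Rightarrow> nat list \<times> nat list \<Rightarrow> nat list" where
  "ascent_insert g x = (\<lambda>(u, w). u @ [x, g] @ w)"
definition valley_insert :: "nat \<Rightarrow> nat \<Rightarrow> nat list \<times> nat list \<Rightarrow> nat list" where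
  "valley_insert g x = (\<lambda>(u, w). u @ [g, x, g] @ w)"
definition peak_insert :: "nat \<Rightarrow> nat list \<times> nat list \<Rightarrow> nat list" where
  "peak_insert x = (\<lambda>(u, w). u @ [x] @ w)"

lemma ascent_insert_in:
  assumes "P \<in> pointed g v" "Suc v < g"
  shows "ascent_insert g (Suc v) P \<in> gap_words g (Suc v)"
proof -
  obtain u w where P: "P = (u, w)" by force
  note D = pointedD[OF assms(1)[unfolded P] Suc_lessD[OF assms(2)]]
  have n: "Suc v \<notin> set u" "Suc v \<notin> set w" using D(9) assms by auto
  show ?thesis
    using D assms n unfolding P ascent_insert_def gap_words_def atLeast0_atMost_Suc
    by (cases "w = []") (auto simp: successively_append_iff successively_Cons allowed_def)
qed

lemma valley_insert_in:
  assumes "P \<in> pointed g v" "Suc v < g" "odd (Suc v)"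
  shows "valley_insert g (Suc v) P \<in> gap_words g (Suc v)"
proof -
  obtain u w where P: "P = (u, w)" by force
  note D = pointedD[OF assms(1)[unfolded P] Suc_lessD[OF assms(2)]]
  have n: "Suc v \<notin> set u" "Suc v \<notin> set w" using D(9) assms by auto
  show ?thesis
    using D assms n unfolding P valley_insert_def gap_words_def atLeast0_atMost_Suc
    by (cases "w = []") (auto simp: successively_append_iff successively_Cons allowed_def)
qed

lemma peak_insert_in:
  assumes "P \<in> pointed g v" "snd P \<noteq> []" "Suc v < g" "even (Suc v)"
  shows "peak_insert (Suc v) P \<in> gap_words g (Suc v)"
proof -
  obtain u w where P: "P = (u, w)" by force
  note D = pointedD[OF assms(1)[unfolded P] Suc_lessD[OF assms(3)]]
  have n: "Suc v \<notin> set u" "Suc v \<notin> set w" using D(9) assms by auto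
  have g: "g \<in> set w" using D(5) assms P last_in_set[of w] by auto
  show ?thesis
    using D assms n g unfolding P peak_insert_def gap_words_def atLeast0_atMost_Suc
    by (auto simp: successively_append_iff successively_Cons allowed_def)
qed

text \<open>
  The neighbours of the largest letter \<open>v + 1\<close> tell how it was inserted. Each neighbour is
  either a gap or a smaller letter; a smaller letter on the right makes \<open>v + 1\<close> a descent top,
  so it is even and its left neighbour cannot be a gap, since the step from a gap goes down to
  an odd letter.
\<close>

lemma gap_words_Suc_cases:
  assumes W: "W \<in> gap_words g (Suc v)" "Suc v < g"
  obtains (ascent) P where "P \<in> pointed g v" "W = ascent_insert g (Suc v) P"
  | (valley) P where "P \<in> pointed g v" "W = valley_insert g (Suc v) P" "odd (Suc v)"
  | (peak) P where "P \<in> pointed g v" "snd P \<noteq> []" "W = peak_insert (Suc v) P" "even (Suc v)"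
proof -
  let ?x = "Suc v"
  have "?x \<in> set W" using W by (auto simp: gap_words_def)
  then obtain u w where W': "W = u @ ?x # w" by (metis split_list)
  have w: "w \<noteq> []" "last w = g" and u: "u \<noteq> []" "hd u = 0"
    using W W' by (auto simp: gap_words_def hd_append split: if_splits)
  have s: "set u \<union> set w \<subseteq> insert g {0..Suc v}" "{0..Suc v} \<subseteq> insert ?x (set u \<union> set w)"
    and d: "distinct (filter (\<lambda>z. z \<noteq> g) u)" "distinct (filter (\<lambda>z. z \<noteq> g) w)"
    "set u \<inter> set w \<subseteq> {g}" "?x \<notin> set u" "?x \<notin> set w"
    and suc: "successively (allowed g) u" "successively (allowed g) w" "allowed g (last u) ?x" "allowed g ?x (hd w)"
    using W W' w u unfolding gap_words_def
    by (auto simp: successively_append_iff successively_Cons)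
  have s1: "set u \<union> set w \<subseteq> insert g {0..v}" "{0..v} \<subseteq> set u \<union> set w"
    using s d(4,5) by (auto simp: le_Suc_eq)
  have lu: "last u \<in> insert g {0..v}" and hw: "hd w \<in> insert g {0..v}"
    using s1(1) u w by (meson Un_iff last_in_set hd_in_set subsetD)+
  note succ = successively_append_iff successively_Cons
  show thesis
  proof (cases "hd w = g")
    case True
    then obtain w' where w': "w = g # w'" using w by (cases w) auto
    have s2: "set u \<union> set w' \<subseteq> insert g {0..v}" "{0..v} \<subseteq> set u \<union> set w'"
      using s1 assms w' by auto
    have w'2: "w' \<noteq> [] \<Longrightarrow> last w' = g" "w' \<noteq> [] \<Longrightarrow> allowed g g (hd w')"
      "successively (allowed g) w'"
      using w w' suc(2) by (auto simp: succ)
    have w'3: "w' \<noteq> [] \<Longrightarrow> hd w' < g \<and> odd (hd w')"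
    proof -
      assume n: "w' \<noteq> []"
      then have "hd w' \<in> insert g {0..v}" using s2(1) by (meson Un_iff hd_in_set subsetD)
      then show ?thesis using w'2(2)[OF n] assms by (auto simp: allowed_def)
    qed
    show thesis
    proof (cases "last u = g")
      case True
      then obtain u' where u': "u = u' @ [g]" using u by (metis append_butlast_last_id)
      have u'n: "u' \<noteq> []" using u u' assms by (cases u') auto
      have "last u' \<in> set u" using u'n u' by simp
      then have "last u' \<in> insert g {0..v}" using s2(1) by auto
      moreover have "allowed g (last u') g" using suc(1) u' u'n by (auto simp: succ)
      ultimately have "last u' < g" using assms by (auto simp: allowed_def)
      moreover have "odd ?x" using suc(3) True assms by (auto simp: allowed_def)
      moreover have "(u', w') \<in> pointed g v"
        by (rule pointedI) (use u u' u'n w' w'2 w'3 s2 suc(1) d assms calculation in \<open>auto simp: succ\<close>)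
      ultimately show thesis using that(2)[of "(u', w')"] W' u' w' by (simp add: valley_insert_def)
    next
      case False
      then have "last u < g" using lu assms by auto
      then have "(u, w') \<in> pointed g v"
        by (intro pointedI) (use u w' w'2 w'3 s2 suc(1) d assms in \<open>auto simp: succ\<close>)
      then show thesis using that(1)[of "(u, w')"] W' w' by (simp add: ascent_insert_def)
    qed
  next
    case False
    then have "hd w < ?x" "hd w < g" using hw assms by auto
    then have ev: "even ?x" "odd (hd w)" using suc(4) assms by (auto simp: allowed_def)
    have "last u < g" using suc(3) lu ev assms by (auto simp: allowed_def)
    then have "(u, w) \<in> pointed g v"
      by (intro pointedI) (use u w s1 suc(1,2) d assms ev \<open>hd w < g\<close> in auto)
    then show thesis using that(3)[of "(u, w)"] W' w ev by (simp add: peak_insert_def)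
  qed
qed

lemma gap_words_0: "0 < g \<Longrightarrow> gap_words g 0 = {[0, g]}"
proof (rule set_eqI, rule iffI)
  fix w assume g: "0 < g" and w: "w \<in> gap_words g 0"
  then obtain r where r: "w = 0 # r" by (cases w) (auto simp: gap_words_def)
  with g w have r': "r \<noteq> []" "last r = g" "set r \<subseteq> {g}" "successively (allowed g) r"
    by (auto simp: gap_words_def successively_Cons)
  then obtain r2 where r2: "r = g # r2" by (cases r) auto
  have "r2 = []" using r' r2 by (cases r2) (auto simp: allowed_def)
  then show "w \<in> {[0, g]}" using r r2 by simp
qed (auto simp: gap_words_def allowed_def)

lemma finite_splits: "finite {(u, w). u @ g # w = W}"
proof (rule finite_subset)
  show "{(u, w). u @ g # w = W} \<subseteq> (\<lambda>n. (take n W, drop (Suc n) W)) ` {..length W}"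
  proof
    fix P assume "P \<in> {(u, w). u @ g # w = W}"
    then obtain u w where P: "P = (u, w)" "W = u @ g # w" by auto
    then have "P = (take (length u) W, drop (Suc (length u)) W)" "length u \<in> {..length W}"
      by auto
    then show "P \<in> (\<lambda>n. (take n W, drop (Suc n) W)) ` {..length W}" by blast
  qed
qed simp

section \<open>Summation over marked gaps\<close>

text \<open>
  The gaps of a fixed word are distinguished by the number \<open>i\<close> of gaps before them.
\<close>

lemma sum_splits:
  fixes f :: "nat \<Rightarrow> nat \<Rightarrow> 'a::comm_ring_1"
  shows "(\<Sum>(u, w)\<in>{(u, w). u @ g # w = W}. f (count_list u g) (count_list w g))
    = (\<Sum>i<count_list W g. f i (count_list W g - 1 - i))"
proof (induction W arbitrary: f)
  case Nil
  then show ?case by simp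
next
  case (Cons x W)
  let ?S = "{(u, w). u @ g # w = W}"
  let ?h = "\<lambda>(u, w). (x # u, w)"
  have inj: "inj_on ?h ?S" by (auto simp: inj_on_def)
  have eq: "{(u, w). u @ g # w = x # W} = ?h ` ?S \<union> (if x = g then {([], W)} else {})"
    by (auto simp: Cons_eq_append_conv append_eq_Cons_conv image_iff)
  have *: "(\<Sum>(u, w)\<in>?h ` ?S. f (count_list u g) (count_list w g))
     = (\<Sum>(u, w)\<in>?S. f (count_list (x # u) g) (count_list w g))"
    by (subst sum.reindex[OF inj]) (simp add: case_prod_unfold)
  have fin: "finite ?S" by (rule finite_splits)
  show ?case
  proof (cases "x = g")
    case True
    have "(\<Sum>(u, w)\<in>{(u, w). u @ g # w = x # W}. f (count_list u g) (count_list w g))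
      = f 0 (count_list W g) + (\<Sum>(u, w)\<in>?S. f (Suc (count_list u g)) (count_list w g))"
      unfolding eq using fin True
      by (subst sum.union_disjoint) (auto simp: *[unfolded True])
    also have "\<dots> = (\<Sum>i<count_list (x # W) g. f i (count_list (x # W) g - 1 - i))"
      using True Cons[of "\<lambda>i. f (Suc i)"] by (simp add: sum.lessThan_Suc_shift del: sum.lessThan_Suc)
    finally show ?thesis .
  next
    case False
    then have "(\<Sum>(u, w)\<in>?h ` ?S. f (count_list u g) (count_list w g))
       = (\<Sum>(u, w)\<in>?S. f (count_list u g) (count_list w g))"
      unfolding * by simp
    then show ?thesis unfolding eq using False Cons[of f] by (simp only: if_False Un_empty_right count_list.simps)
  qed
qed

lemma finite_gap_words: "v < g \<Longrightarrow> finite (gap_words g v)"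
proof (induction v)
  case 0
  then show ?case by (simp add: gap_words_0)
next
  case (Suc v)
  have "pointed g v \<subseteq> (\<Union>W\<in>gap_words g v. {(u, w). u @ g # w = W})"
    by (auto simp: pointed_def)
  then have fin: "finite (pointed g v)"
    by (rule finite_subset) (use Suc finite_splits in auto)
  have "gap_words g (Suc v) \<subseteq> ascent_insert g (Suc v) ` pointed g v
      \<union> valley_insert g (Suc v) ` pointed g v \<union> peak_insert (Suc v) ` pointed g v"
    by (rule subsetI, erule gap_words_Suc_cases[OF _ Suc.prems]) simp_all
  then show ?case by (rule finite_subset) (use fin in simp)
qed

text \<open>
  The number of gaps is the level of the word; it is the height of the associated lattice path
  plus one.
\<close>

definition level_words :: "nat \<Rightarrow> nat \<Rightarrow> nat \<Rightarrow> nat list set" where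
  "level_words g v k = {W \<in> gap_words g v. count_list W g = k}"

definition pointed_level :: "nat \<Rightarrow> nat \<Rightarrow> nat \<Rightarrow> (nat list \<times> nat list) set" where
  "pointed_level g v k = {(u, w). u @ g # w \<in> level_words g v k}"

lemma pointed_level_iff:
  "(u, w) \<in> pointed_level g v k \<longleftrightarrow>
     (u, w) \<in> pointed g v \<and> Suc (count_list u g + count_list w g) = k"
  by (auto simp: pointed_level_def level_words_def pointed_def)

lemma finite_level_words: "v < g \<Longrightarrow> finite (level_words g v k)"
  using finite_gap_words by (auto simp: level_words_def)

lemma level_words_0: "level_words g v 0 = {}"
proof -
  have "g \<in> set W" if "W \<in> gap_words g v" for W using that by (auto simp: gap_words_def)
  then show ?thesis by (auto simp: level_words_def count_list_0_iff)
qed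

lemma finite_pointed_level: "v < g \<Longrightarrow> finite (pointed_level g v k)"
proof -
  assume "v < g"
  then have "finite (\<Union>W\<in>level_words g v k. {(u, w). u @ g # w = W})"
    by (intro finite_UN_I finite_level_words finite_splits)
  moreover have "pointed_level g v k \<subseteq> (\<Union>W\<in>level_words g v k. {(u, w). u @ g # w = W})"
    by (auto simp: pointed_level_def)
  ultimately show ?thesis by (rule finite_subset[rotated])
qed

text \<open>
  If a contribution depends on the word through \<open>F\<close> and on the marked gap only through the
  numbers of gaps on its two sides, the sum over marked words factors. This factorisation
  produces the brackets $[x,k]_{p,q}$ as weights of the steps of a path.
\<close>

lemma sum_pointed_level:
  fixes f :: "nat \<Rightarrow> nat \<Rightarrow> 'a::comm_ring_1"
  assumes "v < g"
  shows "(\<Sum>(u, w)\<in>pointed_level g v k. F (u @ g # w) * f (count_list u g) (count_list w g))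
    = (\<Sum>W\<in>level_words g v k. F W) * (\<Sum>i<k. f i (k - 1 - i))"
proof -
  let ?h = "\<lambda>(u, w). u @ g # w"
  let ?G = "\<lambda>(u, w). F (u @ g # w) * f (count_list u g) (count_list w g)"
  have "sum ?G (pointed_level g v k) =
     (\<Sum>W\<in>level_words g v k. sum ?G {P \<in> pointed_level g v k. ?h P = W})"
    by (rule sum.group[symmetric])
       (use assms finite_level_words finite_pointed_level in \<open>auto simp: pointed_level_def\<close>)
  also have "\<dots> = (\<Sum>W\<in>level_words g v k. F W * (\<Sum>i<k. f i (k - 1 - i)))"
  proof (rule sum.cong[OF refl])
    fix W assume W: "W \<in> level_words g v k"
    then have c: "count_list W g = k" by (simp add: level_words_def)
    have "{P \<in> pointed_level g v k. ?h P = W} = {(u, w). u @ g # w = W}"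
      using W by (auto simp: pointed_level_def)
    then have "sum ?G {P \<in> pointed_level g v k. ?h P = W} =
       (\<Sum>(u, w)\<in>{(u, w). u @ g # w = W}. F W * f (count_list u g) (count_list w g))"
      by (auto intro: sum.cong)
    also have "\<dots> = F W * (\<Sum>(u, w)\<in>{(u, w). u @ g # w = W}. f (count_list u g) (count_list w g))"
      by (simp add: sum_distrib_left case_prod_unfold)
    finally show "sum ?G {P \<in> pointed_level g v k. ?h P = W} = F W * (\<Sum>i<k. f i (k - 1 - i))"
      by (simp add: sum_splits c)
  qed
  finally show ?thesis by (simp add: sum_distrib_right)
qed

lemma pointed_notin:
  assumes "(u, w) \<in> pointed g v" "Suc v < g"
  shows "Suc v \<notin> set u" "Suc v \<notin> set w"
  using pointedD(9)[OF assms(1) Suc_lessD[OF assms(2)]] assms(2) by auto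

lemma split_at_unique:
  fixes x :: nat
  assumes "x \<notin> set c" "x \<notin> set c'" "c @ x # d = c' @ x # d'"
  shows "c = c' \<and> d = d'"
  using arg_cong[OF assms(3), of "before x"] arg_cong[OF assms(3), of "after x"]
  by (simp add: before_split[OF assms(1)] before_split[OF assms(2)]
      after_split[OF assms(1)] after_split[OF assms(2)])

lemma inj_inserts:
  assumes "Suc v < g"
  shows "inj_on (ascent_insert g (Suc v)) (pointed g v)"
    "inj_on (valley_insert g (Suc v)) (pointed g v)"
    "inj_on (peak_insert (Suc v)) (pointed g v)"
proof -
  show "inj_on (ascent_insert g (Suc v)) (pointed g v)"
  proof (rule inj_onI)
    fix P Q assume a: "P \<in> pointed g v" "Q \<in> pointed g v"
      "ascent_insert g (Suc v) P = ascent_insert g (Suc v) Q"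
    obtain u w where P: "P = (u, w)" by (cases P)
    obtain u' w' where Q: "Q = (u', w')" by (cases Q)
    note n = pointed_notin(1)[OF a(1)[unfolded P] assms] pointed_notin(1)[OF a(2)[unfolded Q] assms]
    have "u @ Suc v # g # w = u' @ Suc v # g # w'"
      using a(3) by (simp add: P Q ascent_insert_def)
    then have "u = u' \<and> g # w = g # w'"
      by (rule split_at_unique[rotated 2]) (use n assms in auto)
    then show "P = Q" by (simp add: P Q)
  qed
  show "inj_on (valley_insert g (Suc v)) (pointed g v)"
  proof (rule inj_onI)
    fix P Q assume a: "P \<in> pointed g v" "Q \<in> pointed g v"
      "valley_insert g (Suc v) P = valley_insert g (Suc v) Q"
    obtain u w where P: "P = (u, w)" by (cases P)
    obtain u' w' where Q: "Q = (u', w')" by (cases Q)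
    note n = pointed_notin(1)[OF a(1)[unfolded P] assms] pointed_notin(1)[OF a(2)[unfolded Q] assms]
    have "(u @ [g]) @ Suc v # g # w = (u' @ [g]) @ Suc v # g # w'"
      using a(3) by (simp add: P Q valley_insert_def)
    then have "(u @ [g]) = (u' @ [g]) \<and> g # w = g # w'"
      by (rule split_at_unique[rotated 2]) (use n assms in auto)
    then show "P = Q" by (simp add: P Q)
  qed
  show "inj_on (peak_insert (Suc v)) (pointed g v)"
  proof (rule inj_onI)
    fix P Q assume a: "P \<in> pointed g v" "Q \<in> pointed g v"
      "peak_insert (Suc v) P = peak_insert (Suc v) Q"
    obtain u w where P: "P = (u, w)" by (cases P)
    obtain u' w' where Q: "Q = (u', w')" by (cases Q)
    note n = pointed_notin(1)[OF a(1)[unfolded P] assms] pointed_notin(1)[OF a(2)[unfolded Q] assms]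
    have "u @ Suc v # w = u' @ Suc v # w'"
      using a(3) by (simp add: P Q peak_insert_def)
    then have "u = u' \<and> w = w'"
      by (rule split_at_unique[rotated 2]) (use n assms in auto)
    then show "P = Q" by (simp add: P Q)
  qed
qed

lemma inserts_disjoint:
  assumes "Suc v < g" "P \<in> pointed g v" "Q \<in> pointed g v"
  shows "ascent_insert g (Suc v) P \<noteq> valley_insert g (Suc v) Q"
    "snd Q \<noteq> [] \<Longrightarrow> ascent_insert g (Suc v) P \<noteq> peak_insert (Suc v) Q"
proof -
  obtain u w u' w' where P: "P = (u, w)" and Q: "Q = (u', w')" by force
  note n = pointed_notin[OF assms(2)[unfolded P] assms(1)]
    pointed_notin[OF assms(3)[unfolded Q] assms(1)]
  note D = pointedD[OF assms(2)[unfolded P] Suc_lessD[OF assms(1)]]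
  note D' = pointedD[OF assms(3)[unfolded Q] Suc_lessD[OF assms(1)]]
  show "ascent_insert g (Suc v) P \<noteq> valley_insert g (Suc v) Q"
  proof
    assume "ascent_insert g (Suc v) P = valley_insert g (Suc v) Q"
    then have "u @ Suc v # g # w = (u' @ [g]) @ Suc v # g # w'"
      by (simp add: P Q ascent_insert_def valley_insert_def)
    then have "u = u' @ [g] \<and> g # w = g # w'"
      by (rule split_at_unique[rotated 2]) (use n assms in auto)
    then show False using D(3) by simp
  qed
  assume w': "snd Q \<noteq> []"
  show "ascent_insert g (Suc v) P \<noteq> peak_insert (Suc v) Q"
  proof
    assume "ascent_insert g (Suc v) P = peak_insert (Suc v) Q"
    then have "u @ Suc v # g # w = u' @ Suc v # w'"
      by (simp add: P Q ascent_insert_def peak_insert_def)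
    then have "u = u' \<and> g # w = w'"
      by (rule split_at_unique[rotated 2]) (use n in auto)
    then show False using D'(6) by auto
  qed
qed

text \<open>
  An odd letter cannot be a descent top and an even letter cannot be a descent bottom. So an
  odd letter keeps the level or raises it by one, and an even letter keeps it or lowers it by
  one.
\<close>

lemma sum_level_words_odd:
  fixes f :: "nat list \<Rightarrow> 'a::comm_ring_1"
  assumes v: "Suc v < g" "even v"
  shows "(\<Sum>W\<in>level_words g (Suc v) (Suc k). f W) =
     (\<Sum>P\<in>pointed_level g v (Suc k). f (ascent_insert g (Suc v) P)) +
     (\<Sum>P\<in>pointed_level g v k. f (valley_insert g (Suc v) P))"
proof -
  let ?A = "ascent_insert g (Suc v)" and ?V = "valley_insert g (Suc v)"
  have sub: "pointed_level g v j \<subseteq> pointed g v" for j by (auto simp: pointed_level_iff)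
  have eq: "level_words g (Suc v) (Suc k) =
      ?A ` pointed_level g v (Suc k) \<union> ?V ` pointed_level g v k" (is "?L = ?R")
  proof
    show "?L \<subseteq> ?R"
    proof
      fix W assume W: "W \<in> ?L"
      then have "W \<in> gap_words g (Suc v)" by (simp add: level_words_def)
      from this v(1) show "W \<in> ?R"
      proof (cases rule: gap_words_Suc_cases)
        case (ascent P)
        then have "P \<in> pointed_level g v (Suc k)" using W v
          by (cases P) (auto simp: ascent_insert_def level_words_def pointed_level_iff)
        with ascent show ?thesis by blast
      next
        case (valley P)
        then have "P \<in> pointed_level g v k" using W v
          by (cases P) (auto simp: valley_insert_def level_words_def pointed_level_iff)
        with valley show ?thesis by blast
      next
        case (peak P)
        then show ?thesis using v by simp
      qed
    qed
    show "?R \<subseteq> ?L"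
    proof -
      have "?A P \<in> ?L" if "P \<in> pointed_level g v (Suc k)" for P
        using that ascent_insert_in[of P g v] v
        by (cases P) (auto simp: level_words_def pointed_level_iff ascent_insert_def)
      moreover have "?V P \<in> ?L" if "P \<in> pointed_level g v k" for P
        using that valley_insert_in[of P g v] v
        by (cases P) (auto simp: level_words_def pointed_level_iff valley_insert_def)
      ultimately show ?thesis by blast
    qed
  qed
  have disj: "?A ` pointed_level g v (Suc k) \<inter> ?V ` pointed_level g v k = {}"
    using sub inserts_disjoint(1)[OF v(1)] by (blast dest: subsetD)
  show ?thesis unfolding eq
    using v disj
    by (subst sum.union_disjoint)
       (auto simp: finite_pointed_level sum.reindex[OF inj_on_subset[OF inj_inserts(1)[OF v(1)] sub]]
         sum.reindex[OF inj_on_subset[OF inj_inserts(2)[OF v(1)] sub]] Suc_lessD)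
qed

lemma sum_level_words_even:
  fixes f :: "nat list \<Rightarrow> 'a::comm_ring_1"
  assumes v: "Suc v < g" "odd v"
  shows "(\<Sum>W\<in>level_words g (Suc v) k. f W) =
     (\<Sum>P\<in>pointed_level g v k. f (ascent_insert g (Suc v) P)) +
     (\<Sum>P\<in>{P \<in> pointed_level g v (Suc k). snd P \<noteq> []}. f (peak_insert (Suc v) P))"
proof -
  let ?A = "ascent_insert g (Suc v)" and ?V = "peak_insert (Suc v)"
  let ?N = "{P \<in> pointed_level g v (Suc k). snd P \<noteq> []}"
  have sub: "pointed_level g v j \<subseteq> pointed g v" for j by (auto simp: pointed_level_iff)
  then have sub2: "?N \<subseteq> pointed g v" by blast
  have eq: "level_words g (Suc v) k =
      ?A ` pointed_level g v k \<union> ?V ` ?N" (is "?L = ?R")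
  proof
    show "?L \<subseteq> ?R"
    proof
      fix W assume W: "W \<in> ?L"
      then have "W \<in> gap_words g (Suc v)" by (simp add: level_words_def)
      from this v(1) show "W \<in> ?R"
      proof (cases rule: gap_words_Suc_cases)
        case (ascent P)
        then have "P \<in> pointed_level g v k" using W v
          by (cases P) (auto simp: ascent_insert_def level_words_def pointed_level_iff)
        with ascent show ?thesis by blast
      next
        case (valley P)
        then show ?thesis using v by simp
      next
        case (peak P)
        then have "P \<in> ?N" using W v
          by (cases P) (auto simp: peak_insert_def level_words_def pointed_level_iff)
        with peak show ?thesis by blast
      qed
    qed
    show "?R \<subseteq> ?L"
    proof -
      have "?A P \<in> ?L" if "P \<in> pointed_level g v k" for P
        using that ascent_insert_in[of P g v] v
        by (cases P) (auto simp: level_words_def pointed_level_iff ascent_insert_def)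
      moreover have "?V P \<in> ?L" if "P \<in> ?N" for P
        using that peak_insert_in[of P g v] v
        by (cases P) (auto simp: level_words_def pointed_level_iff peak_insert_def)
      ultimately show ?thesis by blast
    qed
  qed
  have disj: "?A ` pointed_level g v k \<inter> ?V ` ?N = {}"
    using sub inserts_disjoint(2)[OF v(1)] by (blast dest: subsetD)
  show ?thesis unfolding eq
    using v disj
    by (subst sum.union_disjoint)
       (auto simp: finite_pointed_level sum.reindex[OF inj_on_subset[OF inj_inserts(1)[OF v(1)] sub]]
         sum.reindex[OF inj_on_subset[OF inj_inserts(3)[OF v(1)] sub2]] Suc_lessD)
qed

text \<open>
  Seen from the new largest letter \<open>x\<close>, the descents across \<open>x\<close> are exactly the gaps that are
  followed by a letter; only a final gap has no follower.
\<close>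

lemma straddles_eq_count:
  assumes "successively (allowed g) u" "set u \<subseteq> insert g {0..v}" "v < g" "x = Suc v" "x < g"
  shows "straddles x u + (if u \<noteq> [] \<and> last u = g then 1 else 0) = count_list u g"
  using assms by (induction x u rule: straddles.induct) (auto simp: allowed_def)

section \<open>Weights of words\<close>

text \<open>
  In a word \<open>0 # \<dots> # g\<close> the condition that all earlier letters are smaller also excludes
  earlier gaps, as it must, since they will be filled with larger letters. The letter \<open>2 * j\<close>
  carries the factor \<open>y\<close> for the index \<open>j\<close>, because the status of \<open>2 * j - 1\<close> is known once
  \<open>2 * j\<close> is inserted. The factor \<open>t\<close> of a descent is carried by its bottom.
\<close>

context
  fixes a b p q y t :: "'a::comm_ring_1"
begin

definition letter_weight :: "nat \<Rightarrow> nat list \<Rightarrow> 'a" where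
  "letter_weight x W =
     (if even x
      then (if \<forall>z\<in>set (before x W). z < x then a else 1) *
           (if is_top x W \<and> is_bottom (x - 1) W then y else 1)
      else (if \<forall>z\<in>set (after x W). x < z then b else 1) *
           (if is_bottom x W then t else 1)) *
     p ^ straddles x (after x W) * q ^ straddles x (before x W)"

definition word_weight :: "nat \<Rightarrow> nat list \<Rightarrow> 'a" where
  "word_weight v W = (\<Prod>x=1..v. letter_weight x W)"

definition level_weight :: "nat \<Rightarrow> nat \<Rightarrow> nat \<Rightarrow> 'a" where
  "level_weight g v k = (\<Sum>W\<in>level_words g v k. word_weight v W)"

lemma same_view_insert:
  assumes P: "(u, w) \<in> pointed g v" and v: "Suc v < g" and x: "x \<le> v"
    and c: "c \<noteq> []" "set c \<subseteq> {Suc v, g}"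
  shows "same_view x (u @ c @ w) (u @ g # w)"
proof -
  have "same_view x (u @ c @ w) (u @ [g] @ w)"
    by (rule same_view_replace_larger)
       (use c x v pointedD(10)[OF P Suc_lessD[OF v]] in auto)
  then show ?thesis by simp
qed

text \<open>
  Old letters keep their weights by \<open>same_view_replace_larger\<close>, so the total weight only
  acquires the factor of the new letter.
\<close>

lemma word_weight_insert:
  assumes P: "(u, w) \<in> pointed g v" and v: "Suc v < g"
    and c: "c \<noteq> []" "set c \<subseteq> {Suc v, g}"
  shows "word_weight (Suc v) (u @ c @ w) =
    word_weight v (u @ g # w) * letter_weight (Suc v) (u @ c @ w)"
proof -
  have "letter_weight x (u @ c @ w) = letter_weight x (u @ g # w)" if "x \<in> {1..v}" for x
  proof -
    have "x \<le> v" "x - 1 \<le> v" using that by auto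
    then have "same_view x (u @ c @ w) (u @ g # w)" "same_view (x - 1) (u @ c @ w) (u @ g # w)"
      using same_view_insert[OF P v _ c] by blast+
    then show ?thesis unfolding letter_weight_def same_view_def by simp
  qed
  then show ?thesis by (simp add: word_weight_def)
qed

lemma all_less_iff_count:
  assumes P: "(u, w) \<in> pointed g v" and v: "Suc v < g"
  shows "(\<forall>z\<in>set u. z < Suc v) \<longleftrightarrow> count_list u g = 0"
  using pointedD(9)[OF P Suc_lessD[OF v]] v by (auto simp: count_list_0_iff)

text \<open>
  A new letter is a right-to-left minimum only in the last gap: any later gap is preceded by a
  smaller letter. The letters following the new one are written with the gap \<open>g\<close> kept in
  front.
\<close>

lemma all_greater_iff_count:
  assumes P: "(u, w) \<in> pointed g v" and v: "Suc v < g"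
  shows "(\<forall>z\<in>set (g # w). Suc v < z) \<longleftrightarrow> count_list w g = 0"
proof (cases "w = []")
  case False
  then have "hd w \<in> set w" "\<not> Suc v < hd w" "g \<in> set w"
    using pointedD(5,8)[OF P Suc_lessD[OF v]] last_in_set[of w] by auto
  then show ?thesis by (auto simp: count_list_0_iff)
qed (use v in simp)

lemma straddles_pointed:
  assumes P: "(u, w) \<in> pointed g v" and v: "Suc v < g"
  shows "straddles (Suc v) u = count_list u g"
    "straddles (Suc v) (g # w) = count_list w g"
    "w \<noteq> [] \<Longrightarrow> straddles (Suc v) w = count_list w g - 1"
proof -
  note D = pointedD[OF P Suc_lessD[OF v]]
  show "straddles (Suc v) u = count_list u g"
    using straddles_eq_count[of g u v "Suc v"] D v by auto
  have "successively (allowed g) (g # w)"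
    using D by (cases "w = []") (auto simp: successively_Cons allowed_def)
  then show "straddles (Suc v) (g # w) = count_list w g"
    using straddles_eq_count[of g "g # w" v "Suc v"] D v by (cases "w = []") auto
  show "w \<noteq> [] \<Longrightarrow> straddles (Suc v) w = count_list w g - 1"
    using straddles_eq_count[of g w v "Suc v"] D v by auto
qed

lemma is_bottom_ascent:
  assumes P: "(u, w) \<in> pointed g v" and v: "Suc v < g"
  shows "\<not> is_bottom (Suc v) (ascent_insert g (Suc v) (u, w))"
  using pointed_notin[OF P v] pointedD(1,4)[OF P Suc_lessD[OF v]]
  by (auto simp: ascent_insert_def is_bottom_def before_split)

lemma is_bottom_valley:
  assumes P: "(u, w) \<in> pointed g v" and v: "Suc v < g"
  shows "is_bottom (Suc v) (valley_insert g (Suc v) (u, w))"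
proof -
  have n: "Suc v \<notin> set (u @ [g])" using pointed_notin[OF P v] v by simp
  show ?thesis using before_split[OF n, of "g # w"] v
    by (simp add: valley_insert_def is_bottom_def)
qed

lemma letter_weight_ascent:
  assumes P: "(u, w) \<in> pointed g v" and v: "Suc v < g"
  shows "letter_weight (Suc v) (ascent_insert g (Suc v) (u, w)) =
    (if even (Suc v) then (if count_list u g = 0 then a else 1)
     else (if count_list w g = 0 then b else 1)) * p ^ count_list w g * q ^ count_list u g"
proof -
  let ?W = "ascent_insert g (Suc v) (u, w)"
  have W: "?W = u @ Suc v # (g # w)" by (simp add: ascent_insert_def)
  note n = pointed_notin(1)[OF P v]
  have ba: "before (Suc v) ?W = u" "after (Suc v) ?W = g # w"
    unfolding W by (simp_all only: before_split[OF n] after_split[OF n])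
  have "\<not> is_top (Suc v) ?W" using v by (simp add: is_top_def ba)
  then show ?thesis
    using is_bottom_ascent[OF P v]
    unfolding letter_weight_def ba all_less_iff_count[OF P v] all_greater_iff_count[OF P v]
      straddles_pointed[OF P v] by simp
qed

lemma letter_weight_valley:
  assumes P: "(u, w) \<in> pointed g v" and v: "Suc v < g" "odd (Suc v)"
  shows "letter_weight (Suc v) (valley_insert g (Suc v) (u, w)) =
    t * (if count_list w g = 0 then b else 1) * p ^ count_list w g * q ^ count_list u g"
proof -
  let ?W = "valley_insert g (Suc v) (u, w)"
  have W: "?W = (u @ [g]) @ Suc v # (g # w)" by (simp add: valley_insert_def)
  have n: "Suc v \<notin> set (u @ [g])" using pointed_notin(1)[OF P v(1)] v by simp
  have ba: "before (Suc v) ?W = u @ [g]" "after (Suc v) ?W = g # w"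
    unfolding W by (simp_all only: before_split[OF n] after_split[OF n])
  have s: "straddles (Suc v) (u @ [g]) = count_list u g"
    using straddles_pointed(1)[OF P v(1)] v(1) by (simp add: straddles_append)
  show ?thesis
    using is_bottom_valley[OF P v(1)] v(2)
    unfolding letter_weight_def ba all_greater_iff_count[OF P v(1)]
      straddles_pointed[OF P v(1)] s by (simp add: mult.commute)
qed

lemma letter_weight_peak:
  assumes P: "(u, w) \<in> pointed g v" and v: "Suc v < g" "even (Suc v)" and w: "w \<noteq> []"
  shows "letter_weight (Suc v) (peak_insert (Suc v) (u, w)) =
    (if is_bottom v (u @ g # w) then y else 1) * (if count_list u g = 0 then a else 1) *
    p ^ (count_list w g - 1) * q ^ count_list u g"
proof -
  let ?W = "peak_insert (Suc v) (u, w)"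
  have W: "?W = u @ Suc v # w" by (simp add: peak_insert_def)
  note n = pointed_notin(1)[OF P v(1)]
  have ba: "before (Suc v) ?W = u" "after (Suc v) ?W = w"
    unfolding W by (simp_all only: before_split[OF n] after_split[OF n])
  have tp: "is_top (Suc v) ?W" using w pointedD(8)[OF P Suc_lessD[OF v(1)] w]
    by (simp add: is_top_def ba)
  have "is_bottom v ?W = is_bottom v (u @ g # w)"
    using same_view_insert[OF P v(1), of v "[Suc v]"] by (simp add: peak_insert_def same_view_def)
  then show ?thesis
    using tp v(2)
    unfolding letter_weight_def ba all_less_iff_count[OF P v(1)]
      straddles_pointed(1)[OF P v(1)] straddles_pointed(3)[OF P v(1) w] by (simp add: mult.commute)
qed

end

section \<open>The recursion for the level weights\<close>

text \<open>
  In both expansions the summation index \<open>i\<close> is the number of gaps before the new letter. The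
  special weight sits at the first gap for left-to-right maxima, here, and at the last gap for
  right-to-left minima, in \<open>pq_bracket_Suc_swap\<close>. This is why the two brackets have opposite
  orders of $p$ and $q$.
\<close>

lemma pq_bracket_Suc:
  "pq_bracket x (Suc k) p q = (\<Sum>i<Suc k. (if i = 0 then x else 1) * p ^ (k - i) * q ^ i)"
proof -
  have "(\<Sum>i<Suc k. (if i = 0 then x else 1) * p ^ (k - i) * q ^ i) =
      x * p ^ k + (\<Sum>i\<in>{..<Suc k} - {0}. p ^ (k - i) * q ^ i)"
    by (subst sum.remove[of _ 0]) (auto intro!: sum.cong)
  also have "{..<Suc k} - {0} = {1..k}" by auto
  finally show ?thesis by (simp add: pq_bracket_def)
qed

lemma pq_bracket_Suc_swap:
  "pq_bracket x (Suc k) q p =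
     (\<Sum>i<Suc k. (if k - i = 0 then x else 1) * p ^ (k - i) * q ^ i)"
proof -
  have "(\<Sum>i<Suc k. (if k - i = 0 then x else 1) * p ^ (k - i) * q ^ i) =
     (\<Sum>i<Suc k. (if i = 0 then x else 1) * q ^ (k - i) * p ^ i)"
    by (subst sum.nat_diff_reindex[symmetric]) (auto intro!: sum.cong simp: algebra_simps)
  then show ?thesis by (simp only: pq_bracket_Suc)
qed

lemma level_weight_0: "level_weight a b p q y t g v 0 = 0"
  by (simp add: level_weight_def level_words_0)

lemma sum_ascent:
  fixes a b p q y t :: "'a::comm_ring_1"
  assumes v: "Suc v < g"
  shows "(\<Sum>P\<in>pointed_level g v (Suc k).
       word_weight a b p q y t (Suc v) (ascent_insert g (Suc v) P)) =
     (if even (Suc v) then pq_bracket a (Suc k) p q else pq_bracket b (Suc k) q p) *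
     level_weight a b p q y t g v (Suc k)"
proof -
  let ?f = "\<lambda>i j. (if even (Suc v) then (if i = 0 then a else 1) else (if j = 0 then b else 1)) *
    p ^ j * q ^ i"
  have "(\<Sum>P\<in>pointed_level g v (Suc k). word_weight a b p q y t (Suc v) (ascent_insert g (Suc v) P))
    = (\<Sum>(u, w)\<in>pointed_level g v (Suc k). word_weight a b p q y t v (u @ g # w) *
        ?f (count_list u g) (count_list w g))"
  proof (rule sum.cong[OF refl], clarify)
    fix u w assume "(u, w) \<in> pointed_level g v (Suc k)"
    then have P: "(u, w) \<in> pointed g v" by (simp add: pointed_level_iff)
    have "word_weight a b p q y t (Suc v) (ascent_insert g (Suc v) (u, w)) =
      word_weight a b p q y t v (u @ g # w) *
        letter_weight a b p q y t (Suc v) (ascent_insert g (Suc v) (u, w))"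
      using word_weight_insert[OF P v, of "[Suc v, g]"] by (simp add: ascent_insert_def)
    then show "word_weight a b p q y t (Suc v) (ascent_insert g (Suc v) (u, w)) =
      word_weight a b p q y t v (u @ g # w) * ?f (count_list u g) (count_list w g)"
      by (simp only: letter_weight_ascent[OF P v])
  qed
  also have "\<dots> = level_weight a b p q y t g v (Suc k) * (\<Sum>i<Suc k. ?f i (Suc k - 1 - i))"
    unfolding level_weight_def by (rule sum_pointed_level) (use v in simp)
  also have "(\<Sum>i<Suc k. ?f i (Suc k - 1 - i)) =
      (if even (Suc v) then pq_bracket a (Suc k) p q else pq_bracket b (Suc k) q p)"
    using pq_bracket_Suc[of a k p q] pq_bracket_Suc_swap[of b k q p]
    by (simp del: sum.lessThan_Suc)
  finally show ?thesis by (simp only: mult.commute)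
qed

lemma sum_valley:
  fixes a b p q y t :: "'a::comm_ring_1"
  assumes v: "Suc v < g" "even v"
  shows "(\<Sum>P\<in>pointed_level g v k.
       word_weight a b p q y t (Suc v) (valley_insert g (Suc v) P)) =
     t * pq_bracket b k q p * level_weight a b p q y t g v k"
proof (cases k)
  case 0
  then show ?thesis by (simp add: level_weight_0 pointed_level_def level_words_0)
next
  case (Suc k')
  have "(\<Sum>P\<in>pointed_level g v k. word_weight a b p q y t (Suc v) (valley_insert g (Suc v) P))
    = (\<Sum>(u, w)\<in>pointed_level g v k. (t * word_weight a b p q y t v (u @ g # w)) *
        ((if count_list w g = 0 then b else 1) * p ^ count_list w g * q ^ count_list u g))"
  proof (rule sum.cong[OF refl], clarify)
    fix u w assume "(u, w) \<in> pointed_level g v k"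
    then have P: "(u, w) \<in> pointed g v" by (simp add: pointed_level_iff)
    have "word_weight a b p q y t (Suc v) (valley_insert g (Suc v) (u, w)) =
      word_weight a b p q y t v (u @ g # w) * letter_weight a b p q y t (Suc v) (valley_insert g (Suc v) (u, w))"
      using word_weight_insert[OF P v(1), of "[g, Suc v, g]"] by (simp add: valley_insert_def)
    then show "word_weight a b p q y t (Suc v) (valley_insert g (Suc v) (u, w)) =
      (t * word_weight a b p q y t v (u @ g # w)) *
        ((if count_list w g = 0 then b else 1) * p ^ count_list w g * q ^ count_list u g)"
      using v by (simp add: letter_weight_valley[OF P v(1)] mult_ac)
  qed
  also have "\<dots> = (\<Sum>W\<in>level_words g v k. t * word_weight a b p q y t v W) *
     (\<Sum>i<Suc k'. (if k' - i = 0 then b else 1) * p ^ (k' - i) * q ^ i)"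
    by (subst sum_pointed_level[where f="\<lambda>i j. (if j = 0 then b else 1) * p ^ j * q ^ i"
          and F="\<lambda>W. t * word_weight a b p q y t v W"])
       (use v Suc in simp_all)
  also have "\<dots> = (t * level_weight a b p q y t g v k) * pq_bracket b k q p"
    by (simp only: pq_bracket_Suc_swap Suc level_weight_def sum_distrib_left)
  finally show ?thesis by (simp only: mult_ac)
qed

text \<open>
  A peak may fill every gap except the last one, so \<open>k + 2\<close> gaps offer only \<open>k + 1\<close> choices
  and the bracket has index \<open>k + 1\<close>. The last gap is put into the sum with weight zero, so
  that \<open>sum_pointed_level\<close> applies. The factor for \<open>y\<close> depends on the letter \<open>v\<close> of the word
  and not on the chosen gap.
\<close>

lemma sum_peak:
  fixes a b p q y t :: "'a::comm_ring_1"
  assumes v: "Suc v < g" "odd v"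
  shows "(\<Sum>P\<in>{P \<in> pointed_level g v (Suc (Suc k)). snd P \<noteq> []}.
       word_weight a b p q y t (Suc v) (peak_insert (Suc v) P)) =
     pq_bracket a (Suc k) p q * (\<Sum>W\<in>level_words g v (Suc (Suc k)).
        word_weight a b p q y t v W * (if is_bottom v W then y else 1))"
proof -
  let ?f = "\<lambda>i j. if j = 0 then 0 else (if i = 0 then a else 1) * p ^ (j - 1) * q ^ i"
  let ?F = "\<lambda>W. word_weight a b p q y t v W * (if is_bottom v W then y else 1)"
  have "(\<Sum>P\<in>{P \<in> pointed_level g v (Suc (Suc k)). snd P \<noteq> []}.
       word_weight a b p q y t (Suc v) (peak_insert (Suc v) P))
    = (\<Sum>(u, w)\<in>pointed_level g v (Suc (Suc k)).
         ?F (u @ g # w) * ?f (count_list u g) (count_list w g))"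
  proof (rule sum.mono_neutral_cong_left)
    show "finite (pointed_level g v (Suc (Suc k)))" using v by (simp add: finite_pointed_level)
    show "\<forall>P\<in>pointed_level g v (Suc (Suc k)) - {P \<in> pointed_level g v (Suc (Suc k)). snd P \<noteq> []}.
      (case P of (u, w) \<Rightarrow> ?F (u @ g # w) * ?f (count_list u g) (count_list w g)) = 0"
      by auto
    fix P assume "P \<in> {P \<in> pointed_level g v (Suc (Suc k)). snd P \<noteq> []}"
    then obtain u w where P: "P = (u, w)" "(u, w) \<in> pointed g v" "w \<noteq> []"
      by (cases P) (auto simp: pointed_level_iff)
    have "g \<in> set w" using pointedD(5)[OF P(2) Suc_lessD[OF v(1)] P(3)] P(3) last_in_set by metis
    then have c: "count_list w g \<noteq> 0" by (simp add: count_list_0_iff)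
    have "word_weight a b p q y t (Suc v) (peak_insert (Suc v) (u, w)) =
      word_weight a b p q y t v (u @ g # w) * letter_weight a b p q y t (Suc v) (peak_insert (Suc v) (u, w))"
      using word_weight_insert[OF P(2) v(1), of "[Suc v]"] by (simp add: peak_insert_def)
    then show "word_weight a b p q y t (Suc v) (peak_insert (Suc v) P) =
      (case P of (u, w) \<Rightarrow> ?F (u @ g # w) * ?f (count_list u g) (count_list w g))"
      using v c by (simp add: P(1) letter_weight_peak[OF P(2) v(1) _ P(3)] mult_ac)
  qed auto
  also have "\<dots> = (\<Sum>W\<in>level_words g v (Suc (Suc k)). ?F W) * (\<Sum>i<Suc (Suc k). ?f i (Suc k - i))"
    by (subst sum_pointed_level[where f="?f" and F="?F"]) (use v in simp_all)
  also have "(\<Sum>i<Suc (Suc k). ?f i (Suc k - i)) =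
     (\<Sum>i<Suc k. (if i = 0 then a else 1) * p ^ (k - i) * q ^ i)"
    by (subst sum.lessThan_Suc) (auto intro!: sum.cong)
  finally show ?thesis by (simp only: pq_bracket_Suc mult.commute)
qed

text \<open>
  The letters \<open>v + 1\<close> (odd) and \<open>v + 2\<close> (even) together move the level by at most one. There
  are two ways to keep it: both letters are double ascents, or \<open>v + 1\<close> is a descent bottom and
  \<open>v + 2\<close> a descent top. Both have the same weight up to the factor \<open>t * y\<close> of the second way,
  because an odd letter has the same choices whether it opens a gap or not, and an even letter
  closing a gap at level \<open>k + 2\<close> has the same choices as a double ascent at level \<open>k + 1\<close>.
  This coincidence is the source of the factor $1 + ty$.
\<close>

theorem level_weight_step:
  fixes a b p q y t :: "'a::comm_ring_1"
  assumes v: "Suc (Suc v) < g" "even v"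
  defines "Z \<equiv> level_weight a b p q y t g v"
    and "A \<equiv> \<lambda>k. pq_bracket a k p q" and "B \<equiv> \<lambda>k. pq_bracket b k q p"
  shows "level_weight a b p q y t g (Suc (Suc v)) (Suc k) =
     (1 + t * y) * A (Suc k) * B (Suc k) * Z (Suc k) + t * B k * A (Suc k) * Z k +
     B (Suc (Suc k)) * A (Suc k) * Z (Suc (Suc k))"
proof -
  have v1: "Suc v < g" "odd (Suc v)" using v by auto
  \<comment> \<open>used with \<open>c = 1\<close> and with \<open>c = y\<close>, to mark the words in which \<open>v + 1\<close> is a descent bottom\<close>
  have odd: "(\<Sum>W\<in>level_words g (Suc v) (Suc j).
      word_weight a b p q y t (Suc v) W * (if is_bottom (Suc v) W then c else 1)) =
     B (Suc j) * Z (Suc j) + c * t * B j * Z j" for c j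
  proof -
    have mem: "P \<in> pointed_level g v i \<Longrightarrow> (fst P, snd P) \<in> pointed g v" for P i
      by (cases P) (simp add: pointed_level_iff)
    have bot: "\<not> is_bottom (Suc v) (ascent_insert g (Suc v) P)"
      "is_bottom (Suc v) (valley_insert g (Suc v) P)" if "P \<in> pointed_level g v i" for P i
      using is_bottom_ascent[OF mem[OF that] v1(1)] is_bottom_valley[OF mem[OF that] v1(1)] by simp_all
    show ?thesis
      by (simp add: sum_level_words_odd[OF v1(1) v(2)] bot sum_ascent[OF v1(1)] v(2)
          sum_distrib_left[symmetric] sum_valley[OF v1(1) v(2)] Z_def B_def mult_ac cong: sum.cong)
  qed
  have "level_weight a b p q y t g (Suc (Suc v)) (Suc k) =
    A (Suc k) * level_weight a b p q y t g (Suc v) (Suc k) +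
    A (Suc k) * (\<Sum>W\<in>level_words g (Suc v) (Suc (Suc k)).
      word_weight a b p q y t (Suc v) W * (if is_bottom (Suc v) W then y else 1))"
    unfolding level_weight_def[of _ _ _ _ _ _ _ "Suc (Suc v)"] A_def
    by (subst sum_level_words_even[OF v(1) v1(2)])
       (use v(2) in \<open>simp add: sum_ascent[OF v(1)] sum_peak[OF v(1) v1(2)]\<close>)
  also have "level_weight a b p q y t g (Suc v) (Suc k) = B (Suc k) * Z (Suc k) + t * B k * Z k"
    using odd[of 1 k] by (simp add: level_weight_def)
  finally show ?thesis unfolding odd by (simp add: algebra_simps)
qed

lemma level_weight_init:
  assumes "0 < g"
  shows "level_weight a b p q y t g 0 k = (if k = 1 then 1 else 0)"
proof -
  have "level_words g 0 k = (if k = 1 then {[0, g]} else {})"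
    using assms by (auto simp: level_words_def gap_words_0)
  then show ?thesis by (simp add: level_weight_def word_weight_def)
qed

section \<open>From permutations to words\<close>

text \<open>
  A permutation of \<open>{1..m}\<close> fixes \<open>0\<close> and \<open>m + 1\<close>, so its values at \<open>0, \<dots>, m + 1\<close> are
  the framed word, whose only gap is the final letter \<open>m + 1\<close>.
\<close>

definition perm_word :: "nat \<Rightarrow> (nat \<Rightarrow> nat) \<Rightarrow> nat list" where
  "perm_word m \<sigma> = map \<sigma> [0..<Suc (Suc m)]"

lemma permutes_ends:
  assumes "\<sigma> permutes {1..m}"
  shows "\<sigma> 0 = 0" "\<sigma> (Suc m) = Suc m" "i \<in> {1..m} \<Longrightarrow> \<sigma> i \<in> {1..m}"
    "\<sigma> i = \<sigma> j \<longleftrightarrow> i = j"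
proof -
  show "\<sigma> 0 = 0" "\<sigma> (Suc m) = Suc m" using assms by (auto simp: permutes_def)
  show "i \<in> {1..m} \<Longrightarrow> \<sigma> i \<in> {1..m}" using permutes_in_image[OF assms] by blast
  show "\<sigma> i = \<sigma> j \<longleftrightarrow> i = j" using permutes_inj[OF assms] by (auto dest: injD)
qed

lemma perm_word_in_level_words:
  assumes X: "\<sigma> \<in> X_perms n"
  shows "perm_word (2 * n) \<sigma> \<in> level_words (Suc (2 * n)) (2 * n) 1"
proof -
  let ?m = "2 * n" and ?W = "perm_word (2 * n) \<sigma>"
  have perm: "\<sigma> permutes {1..?m}"
    and desc: "\<And>u v. (u, v) \<in> descents ?m \<sigma> \<Longrightarrow> even u \<and> odd v"
    using X by (auto simp: X_perms_def)
  note ends = permutes_ends[OF perm]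
  have dist: "distinct ?W"
    using permutes_inj_on[OF perm] by (simp add: perm_word_def distinct_map del: upt_Suc)
  have "\<sigma> ` {0..Suc ?m} = {0..Suc ?m}"
    by (rule permutes_image[OF permutes_subset[OF perm]]) auto
  then have set: "set ?W = {0..Suc ?m}"
    by (simp add: perm_word_def atLeastLessThanSuc_atLeastAtMost del: upt_Suc)
  have hd: "?W \<noteq> []" "hd ?W = 0" using ends by (auto simp: perm_word_def hd_append upt_conv_Cons simp del: upt_Suc)
  have last: "last ?W = Suc ?m" using ends by (simp add: perm_word_def)
  have suc: "successively (allowed (Suc ?m)) ?W"
    unfolding successively_conv_nth
  proof (intro allI impI)
    fix i assume "Suc i < length ?W"
    then have i: "i \<le> ?m" by (simp add: perm_word_def)
    have nth: "?W ! i = \<sigma> i" "?W ! Suc i = \<sigma> (Suc i)"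
      using i by (simp_all add: perm_word_def nth_append del: upt_Suc)
    have ne: "\<sigma> i \<noteq> \<sigma> (Suc i)" using ends(4) by simp
    show "allowed (Suc ?m) (?W ! i) (?W ! Suc i)"
    proof (cases "\<sigma> i < \<sigma> (Suc i)")
      case False
      then have gt: "\<sigma> i > \<sigma> (Suc i)" using ne by simp
      then have i0: "i \<noteq> 0" using ends(1) by (metis not_less_zero)
      then have "\<sigma> i \<le> ?m" using ends(3)[of i] i by auto
      then have "i \<noteq> ?m" using gt ends(2) by auto
      then have "(\<sigma> i, \<sigma> (Suc i)) \<in> descents ?m \<sigma>"
        using i i0 gt unfolding descents_def by force
      then show ?thesis using gt desc by (simp add: nth allowed_def)
    qed (simp add: nth allowed_def)
  qed
  have "count_list ?W (Suc ?m) = 1"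
    using dist set by (simp add: count_list_eq_length_filter distinct_length_filter)
  moreover have "set ?W = insert (Suc ?m) {0..?m}" unfolding set by auto
  ultimately show ?thesis
    using hd last suc dist by (simp add: level_words_def gap_words_def)
qed

lemma level_words_is_perm_word:
  assumes W: "W \<in> level_words (Suc (2 * n)) (2 * n) 1"
  obtains \<sigma> where "\<sigma> \<in> X_perms n" "W = perm_word (2 * n) \<sigma>"
proof -
  let ?m = "2 * n"
  have hd: "W \<noteq> []" "hd W = 0" "last W = Suc ?m"
    and suc: "successively (allowed (Suc ?m)) W"
    and set: "set W = insert (Suc ?m) {0..?m}"
    and d: "distinct (filter (\<lambda>z. z \<noteq> Suc ?m) W)" and c: "count_list W (Suc ?m) = Suc 0"
    using W by (auto simp: level_words_def gap_words_def)
  obtain xs ys where s: "W = xs @ Suc ?m # ys" "Suc ?m \<notin> set xs" "count_list ys (Suc ?m) = 0"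
    using count_list_Suc_split_first[OF c] by blast
  then have ys: "Suc ?m \<notin> set ys" by (simp add: count_list_0_iff)
  have f: "filter (\<lambda>z. z \<noteq> Suc ?m) zs = zs" if "Suc ?m \<notin> set zs" for zs
    using that by (induction zs) auto
  have "distinct (filter (\<lambda>z. z \<noteq> Suc ?m) xs @ filter (\<lambda>z. z \<noteq> Suc ?m) ys)"
    using d unfolding s(1) by simp
  then have "distinct (xs @ ys)" by (simp only: f[OF s(2)] f[OF ys])
  then have dist: "distinct W" using s(2) ys by (simp add: s(1))
  have set': "set W = {0..Suc ?m}" by (simp only: set atLeast0_atMost_Suc)
  have len: "length W = Suc (Suc ?m)" using distinct_card[OF dist] set' by simp
  define \<sigma> where "\<sigma> = (\<lambda>i. if i \<in> {1..?m} then W ! i else i)"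
  have W0: "W ! 0 = 0" using hd by (simp add: hd_conv_nth)
  have Wm: "W ! Suc ?m = Suc ?m" using hd len by (simp add: last_conv_nth)
  have \<sigma>: "\<sigma> i = W ! i" if "i < Suc (Suc ?m)" for i
  proof -
    have "i = 0 \<or> i = Suc ?m \<or> i \<in> {1..?m}" using that by auto
    then show ?thesis by (elim disjE) (simp_all add: \<sigma>_def W0 Wm)
  qed
  have inj: "\<sigma> i = \<sigma> j \<longleftrightarrow> i = j" if "i < Suc (Suc ?m)" "j < Suc (Suc ?m)" for i j
    using that dist len by (simp add: \<sigma> nth_eq_iff_index_eq)
  have im: "\<sigma> i \<in> {1..?m}" if "i \<in> {1..?m}" for i
  proof -
    have "\<sigma> i \<noteq> \<sigma> 0" "\<sigma> i \<noteq> \<sigma> (Suc ?m)" using that inj[of i 0] inj[of i "Suc ?m"] by simp_all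
    then have "\<sigma> i \<noteq> 0" "\<sigma> i \<noteq> Suc ?m" by (auto simp: \<sigma>_def)
    moreover have "\<sigma> i \<in> set W" using that len by (simp add: \<sigma>)
    ultimately show ?thesis using set' by auto
  qed
  have injon: "inj_on \<sigma> {1..?m}" 
  proof (rule inj_onI)
    fix i j assume "i \<in> {1..?m}" "j \<in> {1..?m}" "\<sigma> i = \<sigma> j"
    then show "i = j" using inj[of i j] by simp
  qed
  have "\<sigma> ` {1..?m} = {1..?m}"
    by (rule endo_inj_surj) (use im injon in auto)
  then have perm: "\<sigma> permutes {1..?m}"
    by (intro bij_imp_permutes) (use injon in \<open>auto simp: bij_betw_def \<sigma>_def\<close>)
  have "even u \<and> odd v" if uv: "(u, v) \<in> descents ?m \<sigma>" for u v
  proof -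
    obtain i where i: "u = \<sigma> i" "v = \<sigma> (Suc i)" "1 \<le> i" "i < ?m" "\<sigma> (Suc i) < \<sigma> i"
      using uv unfolding descents_def Suc_eq_plus1 by blast
    have "allowed (Suc ?m) (\<sigma> i) (\<sigma> (Suc i))"
      using suc i len by (simp add: successively_conv_nth \<sigma>)
    moreover have "\<sigma> i \<le> ?m" using im[of i] i by auto
    ultimately show ?thesis using i by (auto simp: allowed_def)
  qed
  then have "\<sigma> \<in> X_perms n" using perm by (auto simp: X_perms_def)
  moreover have "W = perm_word ?m \<sigma>"
    by (rule nth_equalityI) (simp_all add: len perm_word_def \<sigma> del: upt_Suc)
  ultimately show thesis by (rule that)
qed

lemma bij_betw_perm_word:
  "bij_betw (perm_word (2 * n)) (X_perms n) (level_words (Suc (2 * n)) (2 * n) 1)"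
proof -
  have "inj_on (perm_word (2 * n)) (X_perms n)"
  proof (rule inj_onI)
    fix \<sigma> \<tau> assume X: "\<sigma> \<in> X_perms n" "\<tau> \<in> X_perms n"
      and eq: "perm_word (2 * n) \<sigma> = perm_word (2 * n) \<tau>"
    show "\<sigma> = \<tau>"
    proof
      fix i
      show "\<sigma> i = \<tau> i"
      proof (cases "i \<in> {1..2 * n}")
        case True
        then show ?thesis using eq by (simp add: perm_word_def del: upt_Suc)
      next
        case False
        then show ?thesis using X by (simp add: X_perms_def permutes_def)
      qed
    qed
  qed
  moreover have "perm_word (2 * n) ` X_perms n = level_words (Suc (2 * n)) (2 * n) 1"
    using perm_word_in_level_words level_words_is_perm_word by blast
  ultimately show ?thesis by (simp add: bij_betw_def)
qed

lemma before_after_perm_word: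
  assumes perm: "\<sigma> permutes {1..m}" and j: "j \<le> Suc m"
  shows "before (\<sigma> j) (perm_word m \<sigma>) = map \<sigma> [0..<j]"
    "after (\<sigma> j) (perm_word m \<sigma>) = map \<sigma> [Suc j..<Suc (Suc m)]"
proof -
  have "[0..<Suc (Suc m)] = [0..<j] @ j # [Suc j..<Suc (Suc m)]"
    using j upt_add_eq_append[of 0 j "Suc (Suc m) - j"] by (simp add: upt_conv_Cons del: upt_Suc)
  then have w: "perm_word m \<sigma> = map \<sigma> [0..<j] @ \<sigma> j # map \<sigma> [Suc j..<Suc (Suc m)]"
    by (simp add: perm_word_def del: upt_Suc)
  have n: "\<sigma> j \<notin> set (map \<sigma> [0..<j])" using permutes_ends(4)[OF perm] by auto
  show "before (\<sigma> j) (perm_word m \<sigma>) = map \<sigma> [0..<j]"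
    "after (\<sigma> j) (perm_word m \<sigma>) = map \<sigma> [Suc j..<Suc (Suc m)]"
    unfolding w by (rule before_split[OF n], rule after_split[OF n])
qed

lemma straddles_map_upt:
  "straddles x (map f [i..<j]) = card {k. i \<le> k \<and> Suc k < j \<and> x < f k \<and> f (Suc k) < x}"
proof (induction j)
  case (Suc j)
  let ?S = "\<lambda>j. {k. i \<le> k \<and> Suc k < j \<and> x < f k \<and> f (Suc k) < x}"
  show ?case
  proof (cases "i < j")
    case True
    then obtain l where l: "j = Suc l" "i \<le> l" by (cases j) auto
    have fin: "finite (?S j)" by (rule finite_subset[of _ "{..<j}"]) auto
    \<comment> \<open>appending \<open>f j\<close> creates the single new pair starting at \<open>l = j - 1\<close>\<close>
    have "?S (Suc j) = (if f j < x \<and> x < f l then insert l (?S j) else ?S j)"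
      using l by (auto simp: less_Suc_eq)
    then have "card (?S (Suc j)) = card (?S j) + (if f j < x \<and> x < f l then 1 else 0)"
      using fin l by simp
    then show ?thesis using Suc True l by (simp add: straddles_append)
  next
    case False
    then have "?S (Suc j) = {}" by auto
    then show ?thesis using False by (cases "i = j") auto
  qed
qed simp

lemma straddles_before_perm_word:
  assumes perm: "\<sigma> permutes {1..m}"
  shows "(\<Sum>x=1..m. straddles x (before x (perm_word m \<sigma>))) = pat31_2 m \<sigma>"
proof -
  let ?S = "\<lambda>j. {k. Suc k < j \<and> \<sigma> j < \<sigma> k \<and> \<sigma> (Suc k) < \<sigma> j}"
  have "(\<Sum>x=1..m. straddles x (before x (perm_word m \<sigma>))) =
      (\<Sum>j=1..m. straddles (\<sigma> j) (before (\<sigma> j) (perm_word m \<sigma>)))"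
    by (subst sum.permute[OF perm]) simp
  also have "\<dots> = (\<Sum>j=1..m. card (?S j))"
    by (rule sum.cong) (simp_all add: before_after_perm_word[OF perm] straddles_map_upt)
  also have "\<dots> = card (Sigma {1..m} ?S)"
    by (rule card_SigmaI[symmetric]) (auto intro: finite_subset[of _ "{..m}"])
  also have "\<dots> = card ((\<lambda>(j, k). (Suc k, j)) ` Sigma {1..m} ?S)"
    by (rule card_image[symmetric]) (auto simp: inj_on_def)
  also have "(\<lambda>(j, k). (Suc k, j)) ` Sigma {1..m} ?S =
      {(i, j). 2 \<le> i \<and> i < j \<and> j \<le> m \<and> \<sigma> (i - 1) > \<sigma> j \<and> \<sigma> j > \<sigma> i}" (is "?L = ?R")
  proof
    show "?L \<subseteq> ?R"
    proof
      fix P assume "P \<in> ?L"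
      then obtain j k where P: "P = (Suc k, j)"
        and jk: "j \<in> {1..m}" "Suc k < j" "\<sigma> j < \<sigma> k" "\<sigma> (Suc k) < \<sigma> j" by auto
      from jk have "k \<noteq> 0" using permutes_ends(1)[OF perm] by (metis not_less_zero)
      then show "P \<in> ?R" using jk by (simp add: P)
    qed
    show "?R \<subseteq> ?L"
    proof
      fix P assume "P \<in> ?R"
      then obtain i j where P: "P = (i, j)"
        and ij: "2 \<le> i" "i < j" "j \<le> m" "\<sigma> (i - 1) > \<sigma> j" "\<sigma> j > \<sigma> i" by blast
      then have "(j, i - 1) \<in> Sigma {1..m} ?S" by auto
      then have "(\<lambda>(j, k). (Suc k, j)) (j, i - 1) \<in> ?L" by (rule imageI)
      then show "P \<in> ?L" using ij by (simp add: P)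
    qed
  qed
  finally show ?thesis by (simp add: pat31_2_def)
qed

lemma straddles_after_perm_word:
  assumes perm: "\<sigma> permutes {1..m}"
  shows "(\<Sum>x=1..m. straddles x (after x (perm_word m \<sigma>))) = pat2_31 m \<sigma>"
proof -
  let ?S = "\<lambda>j. {k. Suc j \<le> k \<and> Suc k < Suc (Suc m) \<and> \<sigma> j < \<sigma> k \<and> \<sigma> (Suc k) < \<sigma> j}"
  have "(\<Sum>x=1..m. straddles x (after x (perm_word m \<sigma>))) =
      (\<Sum>j=1..m. straddles (\<sigma> j) (after (\<sigma> j) (perm_word m \<sigma>)))"
    by (subst sum.permute[OF perm]) simp
  also have "\<dots> = (\<Sum>j=1..m. card (?S j))"
    by (rule sum.cong) (simp_all add: before_after_perm_word[OF perm] straddles_map_upt del: upt_Suc)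
  also have "\<dots> = card (Sigma {1..m} ?S)"
    by (rule card_SigmaI[symmetric]) (auto intro: finite_subset[of _ "{..m}"])
  also have "Sigma {1..m} ?S =
      {(i, j). 1 \<le> i \<and> i < j \<and> j \<le> m - 1 \<and> \<sigma> j > \<sigma> i \<and> \<sigma> i > \<sigma> (j + 1)}" (is "?L = ?R")
  proof
    show "?L \<subseteq> ?R"
    proof
      fix P assume "P \<in> ?L"
      then obtain j k where P: "P = (j, k)" and jk: "j \<in> {1..m}" "Suc j \<le> k" "Suc k < Suc (Suc m)" "\<sigma> j < \<sigma> k" "\<sigma> (Suc k) < \<sigma> j" by blast
      have "\<sigma> j \<le> m" using permutes_ends(3)[OF perm, of j] jk by auto
      then have "k \<noteq> m" using permutes_ends(2)[OF perm] jk(5) by auto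
      then show "P \<in> ?R" using jk by (simp add: P)
    qed
    show "?R \<subseteq> ?L" by auto
  qed
  finally show ?thesis by (simp add: pat2_31_def)
qed

lemma is_bottom_perm_word:
  assumes perm: "\<sigma> permutes {1..m}" and x: "x \<in> {1..m}"
  shows "is_bottom x (perm_word m \<sigma>) \<longleftrightarrow> x \<in> descent_bottoms m \<sigma>"
proof -
  obtain j where j: "x = \<sigma> j" "j \<in> {1..m}" using permutes_image[OF perm] x by blast
  then obtain l where l: "j = Suc l" by (cases j) auto
  have "is_bottom x (perm_word m \<sigma>) \<longleftrightarrow> \<sigma> j < \<sigma> l"
    using j l by (simp add: is_bottom_def before_after_perm_word[OF perm])
  also have "\<dots> \<longleftrightarrow> x \<in> descent_bottoms m \<sigma>"
  proof
    assume lt: "\<sigma> j < \<sigma> l"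
    then have "l \<noteq> 0" using permutes_ends(1)[OF perm] by (metis not_less_zero)
    then have "(\<sigma> l, \<sigma> j) \<in> descents m \<sigma>" using lt j l by (auto simp: descents_def)
    then show "x \<in> descent_bottoms m \<sigma>" using j(1) by (force simp: descent_bottoms_def)
  next
    assume "x \<in> descent_bottoms m \<sigma>"
    then obtain i where "\<sigma> j = \<sigma> (Suc i)" "\<sigma> (Suc i) < \<sigma> i"
      using j(1) by (auto simp: descent_bottoms_def descents_def)
    then show "\<sigma> j < \<sigma> l" using permutes_ends(4)[OF perm] l by auto
  qed
  finally show ?thesis .
qed

lemma is_top_perm_word:
  assumes perm: "\<sigma> permutes {1..m}" and x: "x \<in> {1..m}"
  shows "is_top x (perm_word m \<sigma>) \<longleftrightarrow> x \<in> descent_tops m \<sigma>"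
proof -
  obtain j where j: "x = \<sigma> j" "j \<in> {1..m}" using permutes_image[OF perm] x by blast
  have "is_top x (perm_word m \<sigma>) \<longleftrightarrow> \<sigma> (Suc j) < \<sigma> j"
    using j by (simp add: is_top_def before_after_perm_word[OF perm] upt_conv_Cons del: upt_Suc)
  also have "\<dots> \<longleftrightarrow> x \<in> descent_tops m \<sigma>"
  proof
    assume lt: "\<sigma> (Suc j) < \<sigma> j"
    then have "j \<noteq> m" using permutes_ends(2)[OF perm] x j by auto
    then have "(\<sigma> j, \<sigma> (Suc j)) \<in> descents m \<sigma>" using lt j by (auto simp: descents_def)
    then show "x \<in> descent_tops m \<sigma>" using j(1) by (force simp: descent_tops_def)
  next
    assume "x \<in> descent_tops m \<sigma>"
    then obtain i where "\<sigma> j = \<sigma> i" "\<sigma> (Suc i) < \<sigma> i"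
      using j(1) by (auto simp: descent_tops_def descents_def)
    then show "\<sigma> (Suc j) < \<sigma> j" using permutes_ends(4)[OF perm] by auto
  qed
  finally show ?thesis .
qed

lemma Collect_permutes:
  assumes "\<sigma> permutes A"
  shows "{\<sigma> j | j. j \<in> A \<and> R (\<sigma> j)} = {x \<in> A. R x}"
proof -
  have "{\<sigma> j | j. j \<in> A \<and> R (\<sigma> j)} = {x \<in> \<sigma> ` A. R x}" by blast
  then show ?thesis by (simp only: permutes_image[OF assms])
qed

lemma lema_perm_word:
  assumes perm: "\<sigma> permutes {1..m}"
  shows "card {x \<in> {1..m}. even x \<and> (\<forall>z\<in>set (before x (perm_word m \<sigma>)). z < x)} = lema m \<sigma>"
proof -
  have "(\<forall>z\<in>set (before (\<sigma> j) (perm_word m \<sigma>)). z < \<sigma> j) \<longleftrightarrow> (\<forall>i\<in>{1..m}. i < j \<longrightarrow> \<sigma> i < \<sigma> j)"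
    if j: "j \<in> {1..m}" for j
  proof -
    have "set (before (\<sigma> j) (perm_word m \<sigma>)) = \<sigma> ` {0..<j}"
      using j by (simp add: before_after_perm_word[OF perm])
    moreover have "{0..<j} = insert 0 {i \<in> {1..m}. i < j}" using j by auto
    moreover have "\<sigma> 0 < \<sigma> j" using permutes_ends(1)[OF perm] permutes_ends(3)[OF perm j] by simp
    ultimately show ?thesis by auto
  qed
  then have "lr_maxima m \<sigma> = {\<sigma> j | j. j \<in> {1..m} \<and> (\<forall>z\<in>set (before (\<sigma> j) (perm_word m \<sigma>)). z < \<sigma> j)}"
    by (auto simp: lr_maxima_def)
  also have "\<dots> = {x \<in> {1..m}. \<forall>z\<in>set (before x (perm_word m \<sigma>)). z < x}"
    by (rule Collect_permutes[OF perm])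
  finally show ?thesis by (auto simp: lema_def intro: arg_cong[where f=card])
qed

lemma romi_perm_word:
  assumes perm: "\<sigma> permutes {1..m}"
  shows "card {x \<in> {1..m}. odd x \<and> (\<forall>z\<in>set (after x (perm_word m \<sigma>)). x < z)} = romi m \<sigma>"
proof -
  have "(\<forall>z\<in>set (after (\<sigma> j) (perm_word m \<sigma>)). \<sigma> j < z) \<longleftrightarrow> (\<forall>i\<in>{1..m}. i > j \<longrightarrow> \<sigma> j < \<sigma> i)"
    if j: "j \<in> {1..m}" for j
  proof -
    have "set (after (\<sigma> j) (perm_word m \<sigma>)) = \<sigma> ` {Suc j..<Suc (Suc m)}"
      using j by (simp add: before_after_perm_word[OF perm] del: upt_Suc)
    moreover have "{Suc j..<Suc (Suc m)} = insert (Suc m) {i \<in> {1..m}. i > j}" using j by auto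
    moreover have "\<sigma> j < \<sigma> (Suc m)" using permutes_ends(2)[OF perm] permutes_ends(3)[OF perm j] by simp
    ultimately show ?thesis by auto
  qed
  then have "rl_minima m \<sigma> = {\<sigma> j | j. j \<in> {1..m} \<and> (\<forall>z\<in>set (after (\<sigma> j) (perm_word m \<sigma>)). \<sigma> j < z)}"
    by (auto simp: rl_minima_def)
  also have "\<dots> = {x \<in> {1..m}. \<forall>z\<in>set (after x (perm_word m \<sigma>)). x < z}"
    by (rule Collect_permutes[OF perm])
  finally show ?thesis by (auto simp: romi_def intro: arg_cong[where f=card])
qed

lemma des_perm_word:
  assumes X: "\<sigma> \<in> X_perms n"
  shows "card {x \<in> {1..2 * n}. odd x \<and> is_bottom x (perm_word (2 * n) \<sigma>)} = des (2 * n) \<sigma>"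
proof -
  let ?m = "2 * n"
  have perm: "\<sigma> permutes {1..?m}" using X by (simp add: X_perms_def)
  have "v \<in> {1..?m} \<and> odd v" if v: "v \<in> descent_bottoms ?m \<sigma>" for v
  proof -
    obtain w where w: "(w, v) \<in> descents ?m \<sigma>"
      using v unfolding descent_bottoms_def by (metis imageE prod.collapse)
    then have "odd v" using X by (auto simp: X_perms_def)
    moreover obtain i where "v = \<sigma> (Suc i)" "i < ?m" using w by (auto simp: descents_def)
    ultimately show ?thesis using permutes_ends(3)[OF perm, of "Suc i"] by auto
  qed
  then have "{x \<in> {1..?m}. odd x \<and> is_bottom x (perm_word ?m \<sigma>)} = descent_bottoms ?m \<sigma>"
    using is_bottom_perm_word[OF perm] by blast
  moreover have "inj_on snd (descents ?m \<sigma>)"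
    using permutes_ends(4)[OF perm] by (auto simp: inj_on_def descents_def)
  ultimately show ?thesis by (simp add: des_def descent_bottoms_def card_image)
qed

lemma dom_perm_word:
  assumes X: "\<sigma> \<in> X_perms n"
  shows "card {x \<in> {1..2 * n}. even x \<and> is_top x (perm_word (2 * n) \<sigma>) \<and>
     is_bottom (x - 1) (perm_word (2 * n) \<sigma>)} = dom_stat n \<sigma>"
proof -
  let ?m = "2 * n"
  have perm: "\<sigma> permutes {1..?m}" using X by (simp add: X_perms_def)
  let ?D = "{j \<in> {1..n}. 2 * j \<in> descent_tops ?m \<sigma> \<and> 2 * j - 1 \<in> descent_bottoms ?m \<sigma>}"
  have iff: "is_top (2 * j) (perm_word ?m \<sigma>) \<longleftrightarrow> 2 * j \<in> descent_tops ?m \<sigma>"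
    "is_bottom (2 * j - 1) (perm_word ?m \<sigma>) \<longleftrightarrow> 2 * j - 1 \<in> descent_bottoms ?m \<sigma>"
    if "j \<in> {1..n}" for j
    using that by (intro is_top_perm_word[OF perm] is_bottom_perm_word[OF perm]; auto)+
  have "{x \<in> {1..?m}. even x \<and> is_top x (perm_word ?m \<sigma>) \<and> is_bottom (x - 1) (perm_word ?m \<sigma>)}
    = (\<lambda>j. 2 * j) ` ?D" (is "?L = ?R")
  proof
    show "?L \<subseteq> ?R"
    proof
      fix x assume x: "x \<in> ?L"
      then obtain j where j: "x = 2 * j" by (auto elim: evenE)
      then have "j \<in> {1..n}" using x by auto
      then have "j \<in> ?D" using x iff j by blast
      then show "x \<in> ?R" using j by blast
    qed
    show "?R \<subseteq> ?L"
    proof clarify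
      fix j assume j: "j \<in> {1..n}" "2 * j \<in> descent_tops ?m \<sigma>" "2 * j - 1 \<in> descent_bottoms ?m \<sigma>"
      then show "2 * j \<in> {1..?m} \<and> even (2 * j) \<and> is_top (2 * j) (perm_word ?m \<sigma>) \<and>
         is_bottom (2 * j - 1) (perm_word ?m \<sigma>)" using iff[OF j(1)] by auto
    qed
  qed
  then show ?thesis by (simp add: dom_stat_def card_image inj_on_def)
qed

lemma prod_if_card:
  fixes c :: "'a::comm_monoid_mult"
  assumes "finite A"
  shows "(\<Prod>x\<in>A. if P x then c else 1) = c ^ card {x \<in> A. P x}"
  using assms by (simp add: prod.inter_filter[symmetric])

theorem X_poly_eq_level_weight:
  fixes a b p q y t :: "'a::comm_ring_1"
  shows "X_poly n a 1 b 1 p q y t = level_weight a b p q y t (Suc (2 * n)) (2 * n) 1"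
proof -
  let ?m = "2 * n"
  have "word_weight a b p q y t ?m (perm_word ?m \<sigma>) =
     a ^ lema ?m \<sigma> * 1 ^ loma ?m \<sigma> * b ^ romi ?m \<sigma> * 1 ^ remi ?m \<sigma> *
     p ^ pat2_31 ?m \<sigma> * q ^ pat31_2 ?m \<sigma> * y ^ dom_stat n \<sigma> * t ^ des ?m \<sigma>"
    if X: "\<sigma> \<in> X_perms n" for \<sigma>
  proof -
    have perm: "\<sigma> permutes {1..?m}" using X by (simp add: X_perms_def)
    let ?W = "perm_word ?m \<sigma>"
    have "letter_weight a b p q y t x ?W =
      (if even x \<and> (\<forall>z\<in>set (before x ?W). z < x) then a else 1) *
      (if odd x \<and> (\<forall>z\<in>set (after x ?W). x < z) then b else 1) *
      p ^ straddles x (after x ?W) * q ^ straddles x (before x ?W) *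
      (if even x \<and> is_top x ?W \<and> is_bottom (x - 1) ?W then y else 1) *
      (if odd x \<and> is_bottom x ?W then t else 1)" for x
      by (simp add: letter_weight_def)
    then have "word_weight a b p q y t ?m ?W =
      (\<Prod>x=1..?m. if even x \<and> (\<forall>z\<in>set (before x ?W). z < x) then a else 1) *
      (\<Prod>x=1..?m. if odd x \<and> (\<forall>z\<in>set (after x ?W). x < z) then b else 1) *
      p ^ (\<Sum>x=1..?m. straddles x (after x ?W)) * q ^ (\<Sum>x=1..?m. straddles x (before x ?W)) *
      (\<Prod>x=1..?m. if even x \<and> is_top x ?W \<and> is_bottom (x - 1) ?W then y else 1) *
      (\<Prod>x=1..?m. if odd x \<and> is_bottom x ?W then t else 1)"
      by (simp only: word_weight_def prod.distrib power_sum)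
    then show ?thesis
      by (simp only: prod_if_card finite_atLeastAtMost lema_perm_word[OF perm] romi_perm_word[OF perm]
          straddles_before_perm_word[OF perm] straddles_after_perm_word[OF perm]
          dom_perm_word[OF X] des_perm_word[OF X] power_one mult_1_right)
  qed
  then have "X_poly n a 1 b 1 p q y t =
      (\<Sum>\<sigma>\<in>X_perms n. word_weight a b p q y t ?m (perm_word ?m \<sigma>))"
    unfolding X_poly_def by (intro sum.cong) auto
  also have "\<dots> = level_weight a b p q y t (Suc ?m) ?m 1"
    unfolding level_weight_def by (rule sum.reindex_bij_betw[OF bij_betw_perm_word])
  finally show ?thesis .
qed

section \<open>Weighted Motzkin paths and their J-fraction\<close>

text \<open>
  The total weight of lattice paths of length \<open>n\<close> from height \<open>0\<close> to height \<open>h\<close> that never go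
  below \<open>0\<close>, where a step leaving height \<open>h\<close> has weight \<open>c h\<close>, \<open>u h\<close> or \<open>d h\<close> if it is level,
  goes up or goes down.
\<close>

primrec motzkin :: "(nat \<Rightarrow> 'a) \<Rightarrow> (nat \<Rightarrow> 'a) \<Rightarrow> (nat \<Rightarrow> 'a) \<Rightarrow> nat \<Rightarrow> nat \<Rightarrow> 'a::comm_ring_1" where
  "motzkin c u d 0 h = (if h = 0 then 1 else 0)"
| "motzkin c u d (Suc n) h =
     c h * motzkin c u d n h + (if h = 0 then 0 else u (h - 1) * motzkin c u d n (h - 1)) +
     d (Suc h) * motzkin c u d n (Suc h)"

lemma motzkin_eq_0: "n < h \<Longrightarrow> motzkin c u d n h = 0"
  by (induction n arbitrary: h) auto

text \<open>
  Height \<open>h\<close> corresponds to level \<open>h + 1\<close>, and one step to the insertion of an odd and an even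
  letter.
\<close>

lemma level_weight_eq_motzkin:
  fixes a b p q y t :: "'a::comm_ring_1"
  defines "A \<equiv> \<lambda>k. pq_bracket a k p q" and "B \<equiv> \<lambda>k. pq_bracket b k q p"
  assumes "2 * n < g"
  shows "level_weight a b p q y t g (2 * n) (Suc h) =
    motzkin (\<lambda>h. (1 + t * y) * A (Suc h) * B (Suc h))
      (\<lambda>h. t * B (Suc h) * A (Suc (Suc h))) (\<lambda>h. B (Suc h) * A h) n h"
  using assms(3)
proof (induction n arbitrary: h)
  case 0
  then show ?case by (simp add: level_weight_init)
next
  case (Suc n)
  have e: "2 * Suc n = Suc (Suc (2 * n))" by simp
  have z: "level_weight a b p q y t g (2 * n) h =
    (if h = 0 then 0 else motzkin (\<lambda>h. (1 + t * y) * A (Suc h) * B (Suc h))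
      (\<lambda>h. t * B (Suc h) * A (Suc (Suc h))) (\<lambda>h. B (Suc h) * A h) n (h - 1))"
    using Suc.IH[of "h - 1"] Suc.prems by (cases h) (simp_all add: level_weight_0)
  show ?case
    unfolding e A_def B_def
    by (subst level_weight_step)
       (use Suc.prems in \<open>simp_all add: Suc.IH[unfolded A_def B_def] z[unfolded A_def B_def]\<close>)
qed

lemma fps_X_power_dvdI:
  fixes f :: "'a::field fps"
  assumes "\<And>i. i < m \<Longrightarrow> fps_nth f i = 0"
  shows "fps_X ^ m dvd f"
proof
  show "f = fps_X ^ m * fps_shift m f"
    using assms by (intro fps_ext) (auto simp: fps_X_power_mult_nth)
qed

lemma fps_nth_eq_0_if_dvd:
  fixes f :: "'a::field fps"
  assumes "fps_X ^ m dvd f" "i < m"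
  shows "fps_nth f i = 0"
  using assms by (auto elim!: dvdE simp: fps_X_power_mult_nth)

text \<open>
  Let $F_h$ be the generating function of the paths ending at height $h$. Their last step
  gives $(1-c_hx)F_h = u_{h-1}xF_{h-1} + d_{h+1}xF_{h+1}$, where the first term on the right
  is $1$ for $h=0$. Cutting this system at height $h+N$, that is discarding the term with
  $F_{h+N+1}$, and eliminating from the top expresses $F_h$ through $F_{h-1}$ by the $N$-th
  convergent started at $h$. The error is of order $x^{h+2N+2}$: $F_{h+N+1}$ has order at
  least $h+N+1$, and the equations of the $N+1$ heights from $h+N$ down to $h$ contribute one
  more factor $x$ each.
\<close>

theorem motzkin_J_fraction:
  fixes c u d lam :: "nat \<Rightarrow> 'a::field"
  assumes lam: "\<And>h. lam (Suc h) = u h * d (Suc h)"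
  shows "has_J_fraction (Abs_fps (\<lambda>n. motzkin c u d n 0)) c lam"
proof -
  define F where "F h = Abs_fps (\<lambda>n. motzkin c u d n h)" for h
  define S where "S h = (if h = 0 then 1 else fps_X * fps_const (u (h - 1)) * F (h - 1))" for h
  let ?J = "J_convergent c lam"
  have sys: "F h * (1 - fps_const (c h) * fps_X) =
      S h + fps_X * fps_const (d (Suc h)) * F (Suc h)" for h
  proof -
    have "F h = S h + fps_X * (fps_const (c h) * F h) + fps_X * (fps_const (d (Suc h)) * F (Suc h))"
    proof (rule fps_ext)
      fix n
      show "fps_nth (F h) n = fps_nth (S h + fps_X * (fps_const (c h) * F h) +
          fps_X * (fps_const (d (Suc h)) * F (Suc h))) n"
        by (cases n; cases h) (simp_all add: F_def S_def mult.assoc)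
    qed
    then show ?thesis by (simp add: algebra_simps)
  qed
  have ord: "fps_X ^ h dvd F h" for h
    by (rule fps_X_power_dvdI) (simp add: F_def motzkin_eq_0)
  have inv: "(1 / D) * D = 1" if "fps_nth D 0 = 1" for D :: "'a fps"
    using that by (simp add: fps_divide_unit inverse_mult_eq_1)
  have approx: "fps_X ^ (h + 2 + 2 * N) dvd F h - ?J N h * S h" for N h
  proof (induction N arbitrary: h)
    case 0
    let ?D = "1 - fps_const (c h) * fps_X"
    have "?J 0 h * ?D = 1" by (simp add: inv)
    then have "F h = ?J 0 h * (F h * ?D)" by (simp add: mult.left_commute)
    then have "F h - ?J 0 h * S h = fps_X * F (Suc h) * (?J 0 h * fps_const (d (Suc h)))"
      unfolding sys by (simp add: algebra_simps)
    moreover have "fps_X ^ (h + 2) dvd fps_X * F (Suc h)"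
      using mult_dvd_mono[OF dvd_refl[of fps_X] ord[of "Suc h"]] by simp
    ultimately show ?case by (simp add: dvd_mult2)
  next
    case (Suc N)
    let ?K = "?J N (h + 1)"
    let ?D = "1 - fps_const (c h) * fps_X - fps_const (lam (h + 1)) * fps_X ^ 2 * ?K"
    have "?J (Suc N) h * ?D = 1" by (simp add: inv)
    then have F: "F h = ?J (Suc N) h * (F h * ?D)" by (simp add: mult.left_commute)
    have FD: "F h * ?D = S h + fps_X * fps_const (d (Suc h)) * (F (Suc h) - ?K * S (Suc h))"
    proof -
      have l: "fps_const (lam (h + 1)) = fps_const (u h) * fps_const (d (Suc h))"
        by (simp add: lam)
      have S': "S (Suc h) = fps_X * fps_const (u h) * F h" by (simp add: S_def)
      have "F h * ?D = F h * (1 - fps_const (c h) * fps_X) -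
          F h * (fps_const (lam (h + 1)) * fps_X ^ 2 * ?K)"
        by (simp only: right_diff_distrib)
      then show ?thesis unfolding sys l S' by (simp only: algebra_simps power2_eq_square)
    qed
    have "F h = ?J (Suc N) h * (S h + fps_X * fps_const (d (Suc h)) * (F (Suc h) - ?K * S (Suc h)))"
      by (rule F[unfolded FD])
    then have "F h - ?J (Suc N) h * S h =
        fps_X * (F (Suc h) - ?K * S (Suc h)) * (?J (Suc N) h * fps_const (d (Suc h)))"
      by (simp add: algebra_simps del: J_convergent.simps)
    moreover have "fps_X ^ (h + 2 + 2 * Suc N) dvd fps_X * (F (Suc h) - ?K * S (Suc h))"
      using mult_dvd_mono[OF dvd_refl[of fps_X] Suc.IH[of "Suc h"]] by simp
    ultimately show ?case by (simp only: dvd_mult2)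
  qed
  show ?thesis
    unfolding has_J_fraction_def
  proof (rule tendsto_fpsI)
    fix n
    have "fps_nth (?J N 0) n = fps_nth (F 0) n" if "n \<le> N" for N
      using fps_nth_eq_0_if_dvd[OF approx[of 0 N], of n] that by (simp add: S_def)
    then show "\<forall>\<^sub>F N in sequentially. fps_nth (?J N 0) n =
        fps_nth (Abs_fps (\<lambda>n. motzkin c u d n 0)) n"
      unfolding F_def[symmetric] by (auto simp: eventually_sequentially)
  qed
qed

section \<open>The gamma expansion\<close>

text \<open>
  The weight of the paths with exactly \<open>k\<close> up steps.
\<close>

primrec motzkin_coeff ::
  "(nat \<Rightarrow> 'a) \<Rightarrow> (nat \<Rightarrow> 'a) \<Rightarrow> (nat \<Rightarrow> 'a) \<Rightarrow> nat \<Rightarrow> nat \<Rightarrow> nat \<Rightarrow> 'a::comm_ring_1" where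
  "motzkin_coeff c u d 0 h k = (if h = 0 \<and> k = 0 then 1 else 0)"
| "motzkin_coeff c u d (Suc n) h k =
     c h * motzkin_coeff c u d n h k +
     (if h = 0 \<or> k = 0 then 0 else u (h - 1) * motzkin_coeff c u d n (h - 1) (k - 1)) +
     d (Suc h) * motzkin_coeff c u d n (Suc h) k"

lemma motzkin_coeff_eq_0: "n + h < 2 * k \<or> n < k \<Longrightarrow> motzkin_coeff c u d n h k = 0"
proof (induction n arbitrary: h k)
  case (Suc n)
  have "motzkin_coeff c u d n h k = 0" "motzkin_coeff c u d n (Suc h) k = 0"
    using Suc.prems by (auto intro!: Suc.IH)
  moreover have "motzkin_coeff c u d n (h - 1) (k - 1) = 0" if "h \<noteq> 0" "k \<noteq> 0"
    using Suc.prems that by (intro Suc.IH) auto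
  ultimately show ?case by simp
qed auto

text \<open>
  A path of length \<open>n\<close> ending at height \<open>h\<close> with \<open>k\<close> up steps has \<open>k - h\<close> down steps and hence
  \<open>n + h - 2 * k\<close> level steps. When \<open>n + h < 2 * k\<close> the truncated exponent is harmless, as
  there is no such path.
\<close>

theorem motzkin_expansion:
  fixes s t :: "'a::comm_ring_1"
  shows "motzkin (\<lambda>h. s * c h) (\<lambda>h. t * u h) d n h =
    (\<Sum>k\<le>n. motzkin_coeff c u d n h k * t ^ k * s ^ (n + h - 2 * k))"
proof (induction n arbitrary: h)
  case (Suc n)
  let ?g = "motzkin_coeff c u d"
  have C: "(\<Sum>k\<le>Suc n. c h * ?g n h k * t ^ k * s ^ (Suc n + h - 2 * k)) =
      s * c h * (\<Sum>k\<le>n. ?g n h k * t ^ k * s ^ (n + h - 2 * k))"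
  proof -
    have "c h * ?g n h k * t ^ k * s ^ (Suc n + h - 2 * k) =
      s * c h * (?g n h k * t ^ k * s ^ (n + h - 2 * k))" for k
    proof (cases "2 * k \<le> n + h")
      case True
      then have "Suc n + h - 2 * k = Suc (n + h - 2 * k)" by simp
      then show ?thesis by (simp add: mult_ac)
    qed (simp add: motzkin_coeff_eq_0)
    then show ?thesis by (simp add: sum_distrib_left motzkin_coeff_eq_0)
  qed
  have U: "(\<Sum>k\<le>Suc n. (if h = 0 \<or> k = 0 then 0 else u (h - 1) * ?g n (h - 1) (k - 1)) *
        t ^ k * s ^ (Suc n + h - 2 * k)) =
      (if h = 0 then 0 else t * u (h - 1) *
        (\<Sum>k\<le>n. ?g n (h - 1) k * t ^ k * s ^ (n + (h - 1) - 2 * k)))"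
    by (cases h) (simp_all add: sum.atMost_Suc_shift sum_distrib_left mult_ac del: sum.atMost_Suc)
  have D: "(\<Sum>k\<le>Suc n. d (Suc h) * ?g n (Suc h) k * t ^ k * s ^ (Suc n + h - 2 * k)) =
      d (Suc h) * (\<Sum>k\<le>n. ?g n (Suc h) k * t ^ k * s ^ (n + Suc h - 2 * k))"
    by (simp add: sum_distrib_left motzkin_coeff_eq_0 mult_ac)
  have "(\<Sum>k\<le>Suc n. ?g (Suc n) h k * t ^ k * s ^ (Suc n + h - 2 * k)) =
     (\<Sum>k\<le>Suc n. c h * ?g n h k * t ^ k * s ^ (Suc n + h - 2 * k)) +
     (\<Sum>k\<le>Suc n. (if h = 0 \<or> k = 0 then 0 else u (h - 1) * ?g n (h - 1) (k - 1)) *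
        t ^ k * s ^ (Suc n + h - 2 * k)) +
     (\<Sum>k\<le>Suc n. d (Suc h) * ?g n (Suc h) k * t ^ k * s ^ (Suc n + h - 2 * k))"
    by (simp only: motzkin_coeff.simps distrib_right sum.distrib)
  then show ?case unfolding C U D by (simp only: motzkin.simps Suc.IH)
qed simp

text \<open>
  Marking up steps by the indeterminate of a polynomial ring recovers the refinement by their
  number, over an arbitrary ring, where comparing values for all \<open>t\<close> would not be enough.
\<close>

lemma coeff_motzkin_poly:
  "coeff (motzkin (\<lambda>h. [:c h:]) (\<lambda>h. monom (u h) 1) (\<lambda>h. [:d h:]) n h) k = motzkin_coeff c u d n h k"
proof (induction n arbitrary: h k)
  case (Suc n)
  then show ?case by (cases h; cases k) (simp_all add: coeff_monom_mult)
qed simp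

lemma const_poly_sum: "[:\<Sum>x\<in>A. f x:] = (\<Sum>x\<in>A. [:f x:])"
  by (simp add: poly_eq_iff coeff_sum coeff_pCons split: nat.split)

lemma pq_bracket_const_poly:
  "pq_bracket [:x:] k [:p:] [:q:] = [:pq_bracket x k p q:]"
  by (simp add: pq_bracket_def poly_const_pow mult.commute flip: const_poly_sum)

lemma E_perms_des_eq: "E_perms_des n k = {\<sigma> \<in> X_perms n. dom_stat n \<sigma> = 0 \<and> des (2 * n) \<sigma> = k}"
  by (auto simp: E_perms_des_def E_perms_def dom_stat_def)

lemma finite_X_perms: "finite (X_perms n)"
  by (rule finite_subset[OF _ finite_permutations[of "{1..2 * n}"]]) (auto simp: X_perms_def)

text \<open>
  The $\mathcal E$-permutations are the permutations in $\mathcal X_{2n}$ with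
  $\mathrm{dom}=0$, so setting \<open>y = 0\<close> selects them, thanks to \<open>0 ^ 0 = 1\<close>.
\<close>

lemma gamma_coeff_eq_coeff:
  fixes a b p q :: "'a::comm_ring_1"
  shows "gamma_coeff n k a b p q =
    coeff (X_poly n [:a:] 1 [:b:] 1 [:p:] [:q:] 0 (monom 1 1)) k"
proof -
  let ?w = "\<lambda>\<sigma>. a ^ lema (2 * n) \<sigma> * b ^ romi (2 * n) \<sigma> * p ^ pat2_31 (2 * n) \<sigma> * q ^ pat31_2 (2 * n) \<sigma>"
  have "coeff ([:a:] ^ lema (2 * n) \<sigma> * 1 ^ loma (2 * n) \<sigma> * [:b:] ^ romi (2 * n) \<sigma> * 1 ^ remi (2 * n) \<sigma> *
      [:p:] ^ pat2_31 (2 * n) \<sigma> * [:q:] ^ pat31_2 (2 * n) \<sigma> * 0 ^ dom_stat n \<sigma> *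
      monom 1 1 ^ des (2 * n) \<sigma>) k =
    (if dom_stat n \<sigma> = 0 \<and> des (2 * n) \<sigma> = k then ?w \<sigma> else 0)" for \<sigma>
    by (simp add: poly_const_pow monom_power power_0_left)
  then have "coeff (X_poly n [:a:] 1 [:b:] 1 [:p:] [:q:] 0 (monom 1 1)) k =
     (\<Sum>\<sigma>\<in>X_perms n. if dom_stat n \<sigma> = 0 \<and> des (2 * n) \<sigma> = k then ?w \<sigma> else 0)"
    unfolding X_poly_def coeff_sum by simp
  then show ?thesis
    by (simp add: gamma_coeff_def E_perms_des_eq sum.inter_filter finite_X_perms)
qed

lemma X_poly_eq_motzkin:
  fixes a b p q y t :: "'a::comm_ring_1"
  shows "X_poly n a 1 b 1 p q y t =
    motzkin (\<lambda>h. (1 + t * y) * (pq_bracket a (Suc h) p q * pq_bracket b (Suc h) q p))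
      (\<lambda>h. t * (pq_bracket b (Suc h) q p * pq_bracket a (Suc (Suc h)) p q))
      (\<lambda>h. pq_bracket b (Suc h) q p * pq_bracket a h p q) n 0"
  using level_weight_eq_motzkin[of n "Suc (2 * n)" a b p q y t 0]
  by (simp add: X_poly_eq_level_weight mult.assoc)

text \<open>
  With \<open>y = 0\<close> the factor \<open>1 + t * y\<close> of the level steps is \<open>1\<close>, and the exponent of the
  indeterminate is the number of up steps.
\<close>

lemma gamma_coeff_eq_motzkin_coeff:
  fixes a b p q :: "'a::comm_ring_1"
  shows "gamma_coeff n k a b p q =
    motzkin_coeff (\<lambda>h. pq_bracket a (Suc h) p q * pq_bracket b (Suc h) q p)
      (\<lambda>h. pq_bracket b (Suc h) q p * pq_bracket a (Suc (Suc h)) p q)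
      (\<lambda>h. pq_bracket b (Suc h) q p * pq_bracket a h p q) n 0 k"
  unfolding gamma_coeff_eq_coeff X_poly_eq_motzkin pq_bracket_const_poly
  by (subst coeff_motzkin_poly[symmetric]) (simp add: smult_monom mult_monom mult.commute)

theorem theorem10:
  fixes a b p q y t :: "'a::field" and \<beta> lam :: "nat \<Rightarrow> 'a"
  assumes "\<And>n. n \<ge> 1 \<Longrightarrow>
    \<beta> (n - 1) = (1 + t * y) * pq_bracket a n p q * pq_bracket b n q p"
  and "\<And>n. n \<ge> 1 \<Longrightarrow>
    lam n = t * pq_bracket a n p q * pq_bracket a (n + 1) p q *
                pq_bracket b n q p * pq_bracket b (n + 1) q p"
  shows "has_J_fraction (1 + Abs_fps (\<lambda>n. if n \<ge> 1 then X_poly n a 1 b 1 p q y t else 0)) \<beta> lam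
    \<and> (\<forall>n\<ge>1. X_poly n a 1 b 1 p q y t =
        (\<Sum>k=0..n div 2. gamma_coeff n k a b p q * t ^ k * (1 + y * t) ^ (n - 2 * k)))"
proof
  let ?c = "\<lambda>h. pq_bracket a (Suc h) p q * pq_bracket b (Suc h) q p"
  let ?u = "\<lambda>h. pq_bracket b (Suc h) q p * pq_bracket a (Suc (Suc h)) p q"
  let ?d = "\<lambda>h. pq_bracket b (Suc h) q p * pq_bracket a h p q"
  have \<beta>: "\<beta> = (\<lambda>h. (1 + t * y) * ?c h)"
  proof
    fix h
    show "\<beta> h = (1 + t * y) * ?c h" using assms(1)[of "Suc h"] by (simp add: mult.assoc)
  qed
  have lam: "lam (Suc h) = t * ?u h * ?d (Suc h)" for h
    using assms(2)[of "Suc h"] by (simp add: mult_ac)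
  have "1 + Abs_fps (\<lambda>n. if n \<ge> 1 then X_poly n a 1 b 1 p q y t else 0) =
      Abs_fps (\<lambda>n. motzkin \<beta> (\<lambda>h. t * ?u h) ?d n 0)"
  proof (rule fps_ext)
    fix n
    show "fps_nth (1 + Abs_fps (\<lambda>n. if n \<ge> 1 then X_poly n a 1 b 1 p q y t else 0)) n =
        fps_nth (Abs_fps (\<lambda>n. motzkin \<beta> (\<lambda>h. t * ?u h) ?d n 0)) n"
      by (cases n) (simp_all add: \<beta> X_poly_eq_motzkin del: motzkin.simps(2))
  qed
  then show "has_J_fraction (1 + Abs_fps (\<lambda>n. if n \<ge> 1 then X_poly n a 1 b 1 p q y t else 0)) \<beta> lam"
    using motzkin_J_fraction[of lam "\<lambda>h. t * ?u h" ?d \<beta>, OF lam] by simp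
  show "\<forall>n\<ge>1. X_poly n a 1 b 1 p q y t =
        (\<Sum>k=0..n div 2. gamma_coeff n k a b p q * t ^ k * (1 + y * t) ^ (n - 2 * k))"
  proof (intro allI impI)
    fix n
    have "X_poly n a 1 b 1 p q y t =
      (\<Sum>k\<le>n. gamma_coeff n k a b p q * t ^ k * (1 + t * y) ^ (n + 0 - 2 * k))"
      unfolding X_poly_eq_motzkin gamma_coeff_eq_motzkin_coeff by (rule motzkin_expansion)
    also have "\<dots> = (\<Sum>k=0..n div 2. gamma_coeff n k a b p q * t ^ k * (1 + y * t) ^ (n - 2 * k))"
    proof (rule sum.mono_neutral_cong_right)
      show "\<forall>k\<in>{..n} - {0..n div 2}.
          gamma_coeff n k a b p q * t ^ k * (1 + t * y) ^ (n + 0 - 2 * k) = 0"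
        by (auto simp: gamma_coeff_eq_motzkin_coeff motzkin_coeff_eq_0)
    qed (auto simp: mult.commute)
    finally show "X_poly n a 1 b 1 p q y t =
        (\<Sum>k=0..n div 2. gamma_coeff n k a b p q * t ^ k * (1 + y * t) ^ (n - 2 * k))" .
  qed
qed

end
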